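(* Let $d\in\mathbb N$. For $\vec t\in\mathcal T_d$ let $h=h_{\vec t}$ be the parametrisation of the polynomial curve $\gamma_{\vec t}$ determined by $\vec t$, and for $w\in\mathbb C^\times$ put $z(w,\vec t)=h(w)$ and $\tilde z(w,\vec t)=\bar h(w^{-1})$, where $\bar h(w)=\overline{h(\bar w)}$. Then on $\mathbb C^\times\times\mathcal T_d$ we have, for $1\le k\le d+1$, $$\frac{\partial z}{\partial t_k}=\{M_k,z\},\quad\frac{\partial\tilde z}{\partial t_k}=\{M_k,\tilde z\},\quad\frac{\partial z}{\partial\bar t_k}=\{z,\tilde M_k\},\quad\frac{\partial\tilde z}{\partial\bar t_k}=\{\tilde z,\tilde M_k\},$$ where $$M_k(w,\vec t)=(z^k(w,\vec t))_++\tfrac12(z^k(w,\vec t))_0,\qquad\tilde M_k(w,\vec t)=(\tilde z^k(w,\vec t))_-+\tfrac12(\tilde z^k(w,\vec t))_0 .$$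
   Context: A polynomial curve of degree at most $d$ is a smooth simple closed curve in $\mathbb C$ with a parametrisation $h(w)=rw+\sum_{j=0}^da_jw^{-j}$, $|w|=1$, $r>0$; this parametrisation is unique, and $h$ is regarded as a function on $\mathbb C^\times$. It is positively oriented if the counterclockwise orientation of $S^1$ induces the counterclockwise orientation of the curve. Exterior harmonic moments of a polynomial curve $\gamma$ encircling the origin: $t_k=\frac1{2\pi\mathrm ik}\oint_\gamma\bar zz^{-k}\,dz$, $k\ge1$; $\pi t_0$ denotes the enclosed area. $\mathcal T_d$ is the set of sequences $\vec t=(t_k)_{k=0}^\infty$ with $t_0>0$, $t_k\in\mathbb C$ for $k\ge1$, $t_k=0$ for $k>d+1$, $|t_2|<\frac12$, $0<t_0<\delta$ and $|t_1|^2<t_0(\frac12-|t_2|)$, where $\delta=\delta(t_2,\dots,t_{d+1})>0$ is small enough that for all such $t_0,t_1$ there is a unique positively oriented polynomial curve $\gamma_{\vec t}$ of degree at most $d$ encircling the origin with enclosed area $\pi t_0$ and exterior harmonic moments $(t_k)_{k\ge1}$, and that its coefficients $r,a_0,\dots,a_d$ depend smoothly on $(t_0,\dots,t_{d+1})$. Derivatives with respect to $t_k,\bar t_k$ ($k\ge1$) are Wirtinger derivatives at fixed $w$. The Poisson bracket is $\{f,g\}=w\frac{\partial f}{\partial w}\frac{\partial g}{\partial t_0}-w\frac{\partial f}{\partial t_0}\frac{\partial g}{\partial w}$. For a Laurent polynomial $f$ in $w$, $f_+$, $f_0$, $f_-$ denote the parts with positive powers, the constant term, and the parts with negative powers of $w$.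 *)

theory Defs
  imports "HOL-Complex_Analysis.Complex_Analysis" "HOL-Computational_Algebra.Polynomial"
begin

section \<open>Polynomial curves\<close>

text \<open>
  A polynomial curve is given by its parametrisation
  \<open>h(w) = r w + a\<^sub>0 + a\<^sub>1 w\<^sup>-\<^sup>1 + \<dots> + a\<^sub>d w\<^sup>-\<^sup>d\<close>, stored as the pair \<open>(r, p)\<close> where
  \<open>p\<close> is the polynomial with coefficients \<open>a\<^sub>j\<close>, evaluated at \<open>1/w\<close>.
\<close>

type_synonym curve = "real \<times> complex poly"

definition param :: "curve \<Rightarrow> complex \<Rightarrow> complex" where
  "param \<gamma> w = of_real (fst \<gamma>) * w + poly (snd \<gamma>) (inverse w)"

definition loop :: "curve \<Rightarrow> real \<Rightarrow> complex" where
  "loop \<gamma> = param \<gamma> \<circ> circlepath 0 1"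

text \<open>Smoothness of the curve means that its parametrisation is regular on the unit circle.\<close>

definition polynomial_curve :: "nat \<Rightarrow> curve \<Rightarrow> bool" where
  "polynomial_curve d \<gamma> \<longleftrightarrow> fst \<gamma> > 0 \<and> degree (snd \<gamma>) \<le> d \<and> simple_path (loop \<gamma>) \<and>
     (\<forall>w. norm w = 1 \<longrightarrow> deriv (param \<gamma>) w \<noteq> 0)"

definition positively_oriented :: "curve \<Rightarrow> bool" where
  "positively_oriented \<gamma> \<longleftrightarrow> (\<forall>u \<in> inside (path_image (loop \<gamma>)). winding_number (loop \<gamma>) u = 1)"

definition encircles_origin :: "curve \<Rightarrow> bool" where
  "encircles_origin \<gamma> \<longleftrightarrow> 0 \<in> inside (path_image (loop \<gamma>))"

definition enclosed_area :: "curve \<Rightarrow> real" where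
  "enclosed_area \<gamma> = measure lebesgue (inside (path_image (loop \<gamma>)))"

definition ext_moment :: "curve \<Rightarrow> nat \<Rightarrow> complex" where
  "ext_moment \<gamma> k =
     1 / (2 * of_real pi * \<i> * of_nat k) * contour_integral (loop \<gamma>) (\<lambda>z. cnj z * inverse z ^ k)"

text \<open>
  A sequence of moments is a function \<open>t :: nat \<Rightarrow> complex\<close> whose entry \<open>t 0\<close> is real.
\<close>

definition curve_with_moments :: "nat \<Rightarrow> (nat \<Rightarrow> complex) \<Rightarrow> curve \<Rightarrow> bool" where
  "curve_with_moments d t \<gamma> \<longleftrightarrow>
     polynomial_curve d \<gamma> \<and> positively_oriented \<gamma> \<and> encircles_origin \<gamma> \<and>
     of_real (enclosed_area \<gamma>) = of_real pi * t 0 \<and> (\<forall>k\<ge>1. ext_moment \<gamma> k = t k)"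

definition curve_of :: "nat \<Rightarrow> (nat \<Rightarrow> complex) \<Rightarrow> curve" where
  "curve_of d t = (THE \<gamma>. curve_with_moments d t \<gamma>)"

section \<open>Derivatives with respect to the moments\<close>

text \<open>
  Derivative in the \<open>k\<close>-th entry along the direction \<open>c\<close>; for \<open>k \<ge> 1\<close> the values \<open>c = 1\<close> and
  \<open>c = \<i>\<close> give the derivatives in the real and the imaginary part of \<open>t k\<close>, and for \<open>k = 0\<close>
  only \<open>c = 1\<close> is used because \<open>t 0\<close> is real.
\<close>

definition shift :: "nat \<Rightarrow> complex \<Rightarrow> (nat \<Rightarrow> complex) \<Rightarrow> real \<Rightarrow> nat \<Rightarrow> complex" where
  "shift k c t s = t(k := t k + of_real s * c)"

definition partial_deriv ::
  "nat \<Rightarrow> complex \<Rightarrow> ((nat \<Rightarrow> complex) \<Rightarrow> 'a::real_normed_vector) \<Rightarrow> (nat \<Rightarrow> complex) \<Rightarrow> 'a" where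
  "partial_deriv k c F t = vector_derivative (\<lambda>s. F (shift k c t s)) (at 0)"

definition d_t0 :: "((nat \<Rightarrow> complex) \<Rightarrow> complex) \<Rightarrow> (nat \<Rightarrow> complex) \<Rightarrow> complex" where
  "d_t0 F t = partial_deriv 0 1 F t"

definition d_t :: "nat \<Rightarrow> ((nat \<Rightarrow> complex) \<Rightarrow> complex) \<Rightarrow> (nat \<Rightarrow> complex) \<Rightarrow> complex" where
  "d_t k F t = (partial_deriv k 1 F t - \<i> * partial_deriv k \<i> F t) / 2"

definition d_tbar :: "nat \<Rightarrow> ((nat \<Rightarrow> complex) \<Rightarrow> complex) \<Rightarrow> (nat \<Rightarrow> complex) \<Rightarrow> complex" where
  "d_tbar k F t = (partial_deriv k 1 F t + \<i> * partial_deriv k \<i> F t) / 2"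

definition moment_space :: "nat \<Rightarrow> (nat \<Rightarrow> complex) set" where
  "moment_space d = {t. t 0 \<in> \<real> \<and> (\<forall>k>d+1. t k = 0)}"

definition directions :: "nat \<Rightarrow> (nat \<times> complex) set" where
  "directions d = insert (0, 1) ({1..d+1} \<times> {1, \<i>})"

text \<open>
  On \<^term>\<open>moment_space d\<close> the product topology of \<open>nat \<Rightarrow> complex\<close> is the Euclidean topology of
  \<open>\<real> \<times> \<complex>\<^sup>d\<^sup>+\<^sup>1\<close>.  Being \<open>n\<close> times continuously differentiable on a relatively open subset is
  expressed by existence and continuity of the iterated real partial derivatives.
\<close>

primrec Cn_on ::
  "nat \<Rightarrow> nat \<Rightarrow> (nat \<Rightarrow> complex) set \<Rightarrow> ((nat \<Rightarrow> complex) \<Rightarrow> 'a::real_normed_vector) \<Rightarrow> bool" where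
  "Cn_on d 0 S F \<longleftrightarrow> continuous_on S F"
| "Cn_on d (Suc n) S F \<longleftrightarrow> continuous_on S F \<and>
     (\<forall>(k, c) \<in> directions d.
        (\<forall>t\<in>S. (\<lambda>s. F (shift k c t s)) differentiable (at 0)) \<and> Cn_on d n S (partial_deriv k c F))"

definition smooth_on_moments ::
  "nat \<Rightarrow> (nat \<Rightarrow> complex) set \<Rightarrow> ((nat \<Rightarrow> complex) \<Rightarrow> 'a::real_normed_vector) \<Rightarrow> bool" where
  "smooth_on_moments d S F \<longleftrightarrow> (\<forall>n. Cn_on d n S F)"

section \<open>The set of admissible moments\<close>

text \<open>The bound \<open>\<delta>\<close> is a function of the list \<open>[t\<^sub>2, \<dots>, t\<^sub>d\<^sub>+\<^sub>1]\<close>.\<close>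

definition moment_set :: "nat \<Rightarrow> (complex list \<Rightarrow> real) \<Rightarrow> (nat \<Rightarrow> complex) set" where
  "moment_set d \<delta> = {t \<in> moment_space d.
     norm (t 2) < 1/2 \<and> 0 < Re (t 0) \<and> Re (t 0) < \<delta> (map t [2..<d+2]) \<and>
     (norm (t 1))\<^sup>2 < Re (t 0) * (1/2 - norm (t 2))}"

text \<open>
  The relative openness makes the derivatives in \<open>t\<^sub>2, \<dots>, t\<^sub>d\<^sub>+\<^sub>1\<close> meaningful; it says that \<open>\<delta>\<close>
  is lower semicontinuous in \<open>(t\<^sub>2, \<dots>, t\<^sub>d\<^sub>+\<^sub>1)\<close>.
\<close>

definition small_enough :: "nat \<Rightarrow> (complex list \<Rightarrow> real) \<Rightarrow> bool" where
  "small_enough d \<delta> \<longleftrightarrow>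
     (\<forall>ts. \<delta> ts > 0) \<and>
     openin (top_of_set (moment_space d)) (moment_set d \<delta>) \<and>
     (\<forall>t \<in> moment_set d \<delta>. \<exists>!\<gamma>. curve_with_moments d t \<gamma>) \<and>
     smooth_on_moments d (moment_set d \<delta>) (\<lambda>t. fst (curve_of d t)) \<and>
     (\<forall>j\<le>d. smooth_on_moments d (moment_set d \<delta>) (\<lambda>t. coeff (snd (curve_of d t)) j))"

section \<open>Laurent polynomials and the Poisson bracket\<close>

definition has_laurent_coeffs :: "(complex \<Rightarrow> complex) \<Rightarrow> (int \<Rightarrow> complex) \<Rightarrow> bool" where
  "has_laurent_coeffs f c \<longleftrightarrow>
     finite {n. c n \<noteq> 0} \<and> (\<forall>w. w \<noteq> 0 \<longrightarrow> f w = (\<Sum>n | c n \<noteq> 0. c n * w powi n))"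

definition laurent_coeff :: "(complex \<Rightarrow> complex) \<Rightarrow> int \<Rightarrow> complex" where
  "laurent_coeff f = (THE c. has_laurent_coeffs f c)"

definition pos_part :: "(complex \<Rightarrow> complex) \<Rightarrow> complex \<Rightarrow> complex" where
  "pos_part f w = (\<Sum>n | n > 0 \<and> laurent_coeff f n \<noteq> 0. laurent_coeff f n * w powi n)"

definition const_part :: "(complex \<Rightarrow> complex) \<Rightarrow> complex" where
  "const_part f = laurent_coeff f 0"

definition neg_part :: "(complex \<Rightarrow> complex) \<Rightarrow> complex \<Rightarrow> complex" where
  "neg_part f w = (\<Sum>n | n < 0 \<and> laurent_coeff f n \<noteq> 0. laurent_coeff f n * w powi n)"

definition poisson ::
  "(complex \<Rightarrow> (nat \<Rightarrow> complex) \<Rightarrow> complex) \<Rightarrow> (complex \<Rightarrow> (nat \<Rightarrow> complex) \<Rightarrow> complex) \<Rightarrow>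
   complex \<Rightarrow> (nat \<Rightarrow> complex) \<Rightarrow> complex" where
  "poisson f g w t =
     w * deriv (\<lambda>u. f u t) w * d_t0 (g w) t - w * d_t0 (f w) t * deriv (\<lambda>u. g u t) w"

section \<open>The functions on \<open>\<complex>\<^sup>\<times> \<times> \<T>\<^sub>d\<close>\<close>

definition conj_fun :: "(complex \<Rightarrow> complex) \<Rightarrow> complex \<Rightarrow> complex" where
  "conj_fun h w = cnj (h (cnj w))"

definition zfun :: "nat \<Rightarrow> complex \<Rightarrow> (nat \<Rightarrow> complex) \<Rightarrow> complex" where
  "zfun d w t = param (curve_of d t) w"

definition ztilde :: "nat \<Rightarrow> complex \<Rightarrow> (nat \<Rightarrow> complex) \<Rightarrow> complex" where
  "ztilde d w t = conj_fun (param (curve_of d t)) (inverse w)"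

definition Mfun :: "nat \<Rightarrow> nat \<Rightarrow> complex \<Rightarrow> (nat \<Rightarrow> complex) \<Rightarrow> complex" where
  "Mfun d k w t = pos_part (\<lambda>u. zfun d u t ^ k) w + const_part (\<lambda>u. zfun d u t ^ k) / 2"

definition Mtilde :: "nat \<Rightarrow> nat \<Rightarrow> complex \<Rightarrow> (nat \<Rightarrow> complex) \<Rightarrow> complex" where
  "Mtilde d k w t = neg_part (\<lambda>u. ztilde d u t ^ k) w + const_part (\<lambda>u. ztilde d u t ^ k) / 2"

end

theory Submission
  imports Defs
begin

text \<open>
  Write \<open>\<theta> = w \<partial>/\<partial>w\<close> and \<open>f\<^sup>~(w) = cnj (f (1 / cnj w))\<close>, so that \<open>\<theta>\<close> changes sign under \<open>~\<close>.  On the unit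
  circle \<open>z\<^sup>~ = cnj z\<close>, hence all moments are circle averages: \<open>k t\<^sub>k\<close> is the mean of \<open>z\<^sup>~ z\<^sup>-\<^sup>k \<theta>z\<close>, and by
  Green's formula \<open>t\<^sub>0\<close> is the mean of \<open>z\<^sup>~ \<theta>z\<close>.  Differentiating a moment and integrating by parts, a
  derivation \<open>\<partial>\<close> of the moments yields the means of \<open>z\<^sup>-\<^sup>k A\<close> for \<open>A = \<theta>z \<partial>z\<^sup>~ - \<theta>z\<^sup>~ \<partial>z\<close>, and since \<open>z\<close> has
  no zeros on or outside the circle these means determine the nonnegative part of the Laurent polynomial
  \<open>A\<close>: it is \<open>1\<close> for \<open>\<partial>\<^sub>0\<close>, that of \<open>\<theta>(z\<^sup>k)\<close> for \<open>\<partial>/\<partial>t\<^sub>k\<close>, and \<open>0\<close> for the conjugate derivation.  The negative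
  parts follow by applying \<open>~\<close>, which gives the string equation \<open>{z, z\<^sup>~} = 1\<close> and \<open>A\<^sub>k = \<theta>M\<^sub>k\<close>.  Finally
  \<open>\<lambda> = \<partial>\<^sub>kz \<partial>\<^sub>0z\<^sup>~ - \<partial>\<^sub>kz\<^sup>~ \<partial>\<^sub>0z\<close> satisfies \<open>\<theta>z \<lambda> = \<partial>\<^sub>kz - \<theta>M\<^sub>k \<partial>\<^sub>0z\<close>, and comparing its behaviour at \<open>\<infinity>\<close> and at \<open>0\<close>
  shows \<open>\<lambda> = - \<partial>\<^sub>0M\<^sub>k\<close>.
\<close>

section \<open>The area enclosed by a closed curve\<close>

text \<open>Lebesgue measure is determined by its values on boxes, and these are products of
  intervals. This lets area integrals be computed by iterated real integration.\<close>

lemma lborel_complex_eq: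
  "(lborel :: complex measure) = distr (lborel \<Otimes>\<^sub>M lborel) borel (\<lambda>(x, y). Complex x y)"
proof (rule lborel_eqI)
  have [measurable]: "(\<lambda>(x, y). Complex x y) \<in> borel_measurable (lborel \<Otimes>\<^sub>M lborel)"
    unfolding Complex_eq by measurable
  show "emeasure (distr (lborel \<Otimes>\<^sub>M lborel) borel (\<lambda>(x, y). Complex x y)) (box l u) =
      ennreal (\<Prod>b\<in>Basis. (u - l) \<bullet> b)"
    if "\<And>b. b \<in> Basis \<Longrightarrow> l \<bullet> b \<le> u \<bullet> b" for l u :: complex
  proof -
    have "Re l \<le> Re u" "Im l \<le> Im u"
      using that[of 1] that[of \<i>] by simp_all
    moreover have "(\<lambda>(x, y). Complex x y) -` box l u \<inter> space (lborel \<Otimes>\<^sub>M lborel) =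
        {Re l<..<Re u} \<times> {Im l<..<Im u}"
      by (auto simp: box_def Basis_complex_def space_pair_measure)
    ultimately show ?thesis
      by (simp add: emeasure_distr lborel.emeasure_pair_measure_Times Basis_complex_def ennreal_mult'')
  qed
qed simp

lemma nn_integral_lborel_complex:
  assumes [measurable]: "f \<in> borel_measurable borel"
  shows "(\<integral>\<^sup>+ u. f u \<partial>lborel) = (\<integral>\<^sup>+ y. \<integral>\<^sup>+ x. f (Complex x y) \<partial>lborel \<partial>lborel)"
proof -
  have [measurable]: "(\<lambda>(x, y). Complex x y) \<in> borel_measurable (lborel \<Otimes>\<^sub>M lborel)"
    unfolding Complex_eq by measurable
  show ?thesis
    by (subst lborel_complex_eq, subst nn_integral_distr)
       (auto simp: lborel_pair.nn_integral_snd[symmetric] split_beta')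
qed

lemma integral_lborel_complex:
  fixes f :: "complex \<Rightarrow> 'a::{banach, second_countable_topology}"
  assumes "integrable lborel f"
  shows "(\<integral> u. f u \<partial>lborel) = (\<integral> y. \<integral> x. f (Complex x y) \<partial>lborel \<partial>lborel)"
proof -
  have [measurable]: "(\<lambda>(x, y). Complex x y) \<in> borel_measurable (lborel \<Otimes>\<^sub>M lborel)"
    unfolding Complex_eq by measurable
  have [measurable]: "f \<in> borel_measurable borel"
    using assms by auto
  have "integrable (lborel \<Otimes>\<^sub>M lborel) (\<lambda>(x, y). f (Complex x y))"
    using assms by (subst (asm) lborel_complex_eq) (simp add: integrable_distr_eq split_beta')
  then show ?thesis
    by (subst lborel_complex_eq, subst integral_distr)
       (auto simp: lborel_pair.integral_snd split_beta')
qed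

section \<open>Integrability of the Cauchy kernel on a square\<close>

lemma nn_integral_inverse_sqrt_finite:
  "(\<integral>\<^sup>+ x. ennreal (indicator {-R..R} x * \<bar>x\<bar> powr (-1/2)) \<partial>lborel) < \<infinity>"
proof (cases "R > 0")
  case True
  have "((\<lambda>x. x powr (-1/2)) has_integral (R powr (-1/2+1) / (-1/2+1))) {0..R}"
    using True by (intro has_integral_powr_from_0) auto
  then have 1: "((\<lambda>x. \<bar>x\<bar> powr (-1/2)) has_integral (2 * R powr (1/2))) {0..R}"
    by (rule has_integral_eq_rhs[OF has_integral_eq[rotated]]) auto
  then have 2: "((\<lambda>x. \<bar>x\<bar> powr (-1/2)) has_integral (2 * R powr (1/2))) {-R..0}"
    using has_integral_reflect_real[where f = "\<lambda>x. \<bar>x\<bar> powr (-1/2)" and a = 0 and b = R] by simp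
  have "((\<lambda>x. \<bar>x\<bar> powr (-1/2)) has_integral (2 * R powr (1/2) + 2 * R powr (1/2))) {-R..R}"
    by (rule has_integral_combine[OF _ _ 2 1]) (use True in auto)
  then have "((\<lambda>x. indicator {-R..R} x * \<bar>x\<bar> powr (-1/2)) has_integral (4 * R powr (1/2))) UNIV"
    using has_integral_restrict_UNIV[of "{-R..R}" "\<lambda>x. \<bar>x\<bar> powr (-1/2)"]
    by (auto simp: indicator_def of_bool_def if_distrib[of "\<lambda>a. a * _"] cong: if_cong)
  then have "(\<integral>\<^sup>+ x. ennreal (indicator {-R..R} x * \<bar>x\<bar> powr (-1/2)) \<partial>lborel) = ennreal (4 * R powr (1/2))"
    by (intro nn_integral_has_integral_lborel) auto
  then show ?thesis by simp
next
  case False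
  then have "ennreal (indicator {-R..R} x * \<bar>x\<bar> powr (-1/2)) = 0" for x :: real
    by (auto simp: indicator_def)
  then show ?thesis by (simp only: nn_integral_const) simp
qed

text \<open>From \<open>\<bar>Re z\<bar> * \<bar>Im z\<bar> \<le> (norm z)\<^sup>2\<close>. The
  planar singularity is split into a product of two one-dimensional ones with exponent above -1, so
  Tonelli applies in Cartesian coordinates.\<close>

lemma inverse_norm_le_powr:
  assumes "Re z \<noteq> 0" "Im z \<noteq> 0"
  shows "1 / norm z \<le> \<bar>Re z\<bar> powr (-1/2) * \<bar>Im z\<bar> powr (-1/2)"
proof -
  have "\<bar>Re z\<bar> * \<bar>Im z\<bar> \<le> (norm z)\<^sup>2"
    by (metis abs_Im_le_cmod abs_Re_le_cmod abs_ge_zero mult_mono norm_ge_zero power2_eq_square)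
  then have "(\<bar>Re z\<bar> * \<bar>Im z\<bar>) powr (1/2) \<le> ((norm z)\<^sup>2) powr (1/2)"
    by (intro powr_mono2) auto
  also have "((norm z)\<^sup>2) powr (1/2) = norm z"
    by (simp add: powr_half_sqrt)
  finally have "1 / norm z \<le> 1 / (\<bar>Re z\<bar> * \<bar>Im z\<bar>) powr (1/2)"
    using assms by (intro divide_left_mono mult_pos_pos) (auto simp: complex_eq_iff)
  also have "\<dots> = \<bar>Re z\<bar> powr (-1/2) * \<bar>Im z\<bar> powr (-1/2)"
    by (simp add: powr_mult powr_minus divide_simps)
  finally show ?thesis .
qed

definition square :: "real \<Rightarrow> complex set" where
  "square R = {u. \<bar>Re u\<bar> \<le> R \<and> \<bar>Im u\<bar> \<le> R}"

lemma square_measurable [measurable]: "square R \<in> sets borel"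
  unfolding square_def by measurable

text \<open>The product majorant is translation invariant, hence the bound does not depend on the
  pole \<open>a\<close>; Fubini along the curve needs this uniformity.\<close>

lemma Cauchy_kernel_bound:
  obtains C where "C < \<infinity>"
    "\<And>a. a \<in> square R \<Longrightarrow> (\<integral>\<^sup>+ u. ennreal (indicator (square R) u * (1 / norm (a - u))) \<partial>lborel) \<le> C"
proof
  \<comment> \<open>The interval is doubled because \<open>a - u\<close> ranges over differences of
    two points of the square.\<close>
  define W where "W = (\<lambda>x::real. ennreal (indicator {-(2*R)..2*R} x * \<bar>x\<bar> powr (-1/2)))"
  define w where "w = (\<integral>\<^sup>+ x. W x \<partial>lborel)"
  have [measurable]: "W \<in> borel_measurable borel"
    unfolding W_def by measurable
  have w: "w < \<infinity>"
    unfolding w_def W_def by (rule nn_integral_inverse_sqrt_finite)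
  show "w * w < \<infinity>"
    using w by (simp add: ennreal_mult_less_top)
  fix a assume a: "a \<in> square R"
  have shift: "(\<integral>\<^sup>+ x. W (b - x) \<partial>lborel) = w" for b
    unfolding w_def using nn_integral_real_affine[of W "-1" b] by simp
  have "(\<integral>\<^sup>+ u. ennreal (indicator (square R) u * (1 / norm (a - u))) \<partial>lborel) =
     (\<integral>\<^sup>+ y. \<integral>\<^sup>+ x. ennreal (indicator (square R) (Complex x y) * (1 / norm (a - Complex x y))) \<partial>lborel \<partial>lborel)"
    by (rule nn_integral_lborel_complex) measurable
  also have "\<dots> \<le> (\<integral>\<^sup>+ y. \<integral>\<^sup>+ x. W (Re a - x) * W (Im a - y) \<partial>lborel \<partial>lborel)"
  proof (intro nn_integral_mono_AE)
    show "AE y in lborel. (\<integral>\<^sup>+ x. ennreal (indicator (square R) (Complex x y) * (1 / norm (a - Complex x y))) \<partial>lborel)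
       \<le> (\<integral>\<^sup>+ x. W (Re a - x) * W (Im a - y) \<partial>lborel)"
      \<comment> \<open>The horizontal and vertical lines through \<open>a\<close> must be left out:
        there one factor of the majorant is \<open>0 powr (-1/2) = 0\<close> and the estimate
        fails.\<close>
      using AE_lborel_singleton[of "Im a"]
    proof eventually_elim
      fix y assume y: "y \<noteq> Im a"
      show "(\<integral>\<^sup>+ x. ennreal (indicator (square R) (Complex x y) * (1 / norm (a - Complex x y))) \<partial>lborel)
       \<le> (\<integral>\<^sup>+ x. W (Re a - x) * W (Im a - y) \<partial>lborel)"
      proof (intro nn_integral_mono_AE)
        show "AE x in lborel. ennreal (indicator (square R) (Complex x y) * (1 / norm (a - Complex x y)))
            \<le> W (Re a - x) * W (Im a - y)"
          using AE_lborel_singleton[of "Re a"]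
        proof eventually_elim
          fix x assume x: "x \<noteq> Re a"
          have "1 / norm (a - Complex x y) \<le> \<bar>Re a - x\<bar> powr (-1/2) * \<bar>Im a - y\<bar> powr (-1/2)"
            using inverse_norm_le_powr[of "a - Complex x y"] x y by simp
          moreover have "Re a - x \<in> {-(2*R)..2*R}" "Im a - y \<in> {-(2*R)..2*R}" if "Complex x y \<in> square R"
            using that a by (auto simp: square_def)
          ultimately show "ennreal (indicator (square R) (Complex x y) * (1 / norm (a - Complex x y)))
            \<le> W (Re a - x) * W (Im a - y)"
            unfolding W_def by (subst ennreal_mult[symmetric]) (auto simp: indicator_def intro!: ennreal_leI)
        qed
      qed
    qed
  qed
  also have "\<dots> = w * w"
    by (simp add: nn_integral_multc nn_integral_cmult shift)
  finally show "(\<integral>\<^sup>+ u. ennreal (indicator (square R) u * (1 / norm (a - u))) \<partial>lborel) \<le> w * w" .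
qed

section \<open>Explicit integrals of the Cauchy kernel\<close>

lemma square_iff_Complex: "Complex x y \<in> square R \<longleftrightarrow> x \<in> {-R..R} \<and> y \<in> {-R..R}"
  by (auto simp: square_def)

lemma continuous_on_Ln_right:
  assumes "continuous_on S f" "\<And>x. x \<in> S \<Longrightarrow> Re (f x) > 0"
  shows "continuous_on S (\<lambda>x. Ln (f x))"
  using assms by (intro continuous_on_Ln') (auto simp: complex_nonpos_Reals_iff, force)

text \<open>The primitive \<open>- Ln (\<zeta> - x)\<close> is smooth since
  \<open>\<zeta> - x\<close> has nonzero imaginary part. At \<open>x = R\<close> the argument lies
  in the left half plane; passing to \<open>Ln (R - \<zeta>)\<close> costs the jump
  \<open>\<plusminus>\<i>\<pi>\<close> but leaves only logarithms that are holomorphic in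
  \<open>a\<close> on the strip \<open>\<bar>Re a\<bar> < R\<close>.\<close>

lemma integral_Cauchy_kernel_line:
  assumes "\<bar>Re a\<bar> < R" "y \<noteq> Im a"
  shows "((\<lambda>x. 1 / (a - Complex x y)) has_integral
     (Ln (a - \<i> * y + R) - Ln (R - a + \<i> * y) - \<i> * pi * sgn (Im a - y))) {-R..R}"
proof -
  define \<zeta> where "\<zeta> = a - \<i> * y"
  have [simp]: "Re \<zeta> = Re a" "Im \<zeta> = Im a - y"
    by (simp_all add: \<zeta>_def)
  have R: "-R \<le> R" using assms by linarith
  have "((\<lambda>x. 1 / (a - Complex x y)) has_integral - Ln (\<zeta> - R) - - Ln (\<zeta> - (-R))) {-R..R}"
  proof -
    have "((\<lambda>x. - Ln (\<zeta> - of_real x)) has_vector_derivative 1 / (a - Complex x y)) (at x within {-R..R})" for x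
    proof (rule has_vector_derivative_real_field)
      have "\<zeta> - of_real x \<notin> \<real>\<^sub>\<le>\<^sub>0"
        using assms by (auto simp: complex_nonpos_Reals_iff)
      then have "((\<lambda>u. - Ln (\<zeta> - u)) has_field_derivative 1 / (\<zeta> - of_real x)) (at (of_real x))"
        by (auto intro!: derivative_eq_intros simp: inverse_eq_divide)
      then show "((\<lambda>u. - Ln (\<zeta> - u)) has_field_derivative 1 / (a - Complex x y)) (at (of_real x))"
        by (simp add: \<zeta>_def Complex_eq algebra_simps)
    qed
    from fundamental_theorem_of_calculus[OF R this] show ?thesis
      by simp
  qed
  moreover have "Ln (\<zeta> - R) = Ln (R - \<zeta>) + \<i> * pi * sgn (Im a - y)"
    using Ln_minus[of "R - \<zeta>"] assms by (cases "Im a > y") (auto simp: complex_eq_iff)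
  ultimately show ?thesis
    by (simp add: \<zeta>_def algebra_simps)
qed

lemma has_integral_sgn:
  fixes b R :: real
  assumes "\<bar>b\<bar> < R"
  shows "((\<lambda>y. sgn (b - y)) has_integral 2 * b) {-R..R}"
proof -
  have "((\<lambda>y. 1) has_integral (b + R)) {-R..b}" "((\<lambda>y. -1) has_integral (b - R)) {b..R}"
    using has_integral_const_real[of "1::real" "-R" b] has_integral_const_real[of "-1::real" b R] assms
    by (auto split: if_splits)
  then have "((\<lambda>y. sgn (b - y)) has_integral (b + R)) {-R..b}" "((\<lambda>y. sgn (b - y)) has_integral (b - R)) {b..R}"
    by (auto elim!: has_integral_spike_finite[of "{b}", rotated -1] simp: sgn_if split: if_splits)
  from has_integral_combine[OF _ _ this] assms show ?thesis
    by (simp add: algebra_simps)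
qed

lemma integrable_Cauchy_kernel:
  assumes "a \<in> square R"
  shows "integrable lborel (\<lambda>u. indicator (square R) u *\<^sub>R (1 / (a - u)))"
proof (rule integrableI_bounded)
  obtain C where "C < \<infinity>"
    "\<And>a. a \<in> square R \<Longrightarrow> (\<integral>\<^sup>+ u. ennreal (indicator (square R) u * (1 / norm (a - u))) \<partial>lborel) \<le> C"
    using Cauchy_kernel_bound by blast
  with assms show "(\<integral>\<^sup>+ u. ennreal (norm (indicator (square R) u *\<^sub>R (1 / (a - u)))) \<partial>lborel) < \<infinity>"
    by (auto simp: norm_divide intro: le_less_trans)
qed measurable

text \<open>Integrating the line formula over the height \<open>y\<close>: the jump term contributes
  \<open>2 * Im a\<close>, the source of the area formula, while the logarithms are left unevaluated
  because they drop out along a closed curve.\<close>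

lemma integral_Cauchy_kernel_square:
  assumes "\<bar>Re a\<bar> < R" "\<bar>Im a\<bar> < R"
  shows "(\<integral>u. indicator (square R) u *\<^sub>R (1 / (a - u)) \<partial>lborel) =
     integral {-R..R} (\<lambda>y::real. Ln (a - \<i> * y + R) - Ln (R - a + \<i> * y)) - 2 * \<i> * pi * Im a"
proof -
  define L where "L = (\<lambda>y::real. Ln (a - \<i> * y + R) - Ln (R - a + \<i> * y))"
  define E where "E = (\<lambda>y. L y - \<i> * pi * sgn (Im a - y))"
  have contL: "continuous_on {-R..R} L"
    unfolding L_def using assms by (intro continuous_intros continuous_on_Ln_right) auto
  have intL: "set_integrable lborel {-R..R} L"
    by (rule borel_integrable_atLeastAtMost'[OF contL])
  have int_sgn: "set_integrable lborel {-R..R} (\<lambda>y. sgn (Im a - y))"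
    unfolding set_integrable_def
    by (rule Bochner_Integration.integrable_bound[of lborel "indicator {-R..R} :: real \<Rightarrow> real"])
       (auto simp: indicator_def sgn_if emeasure_lborel_Icc_eq intro!: integrable_real_indicator)
  have int_sgn': "set_integrable lborel {-R..R} (\<lambda>y. \<i> * pi * complex_of_real (sgn (Im a - y)))"
    using integrable_mult_right[OF integrable_of_real[OF int_sgn[unfolded set_integrable_def], where 'a = complex],
        of "\<i> * pi"]
    by (simp add: set_integrable_def scaleR_conv_of_real algebra_simps)
  have line: "(\<integral>x. indicator (square R) (Complex x y) *\<^sub>R (1 / (a - Complex x y)) \<partial>lborel) =
      indicator {-R..R} y *\<^sub>R E y" if y: "y \<noteq> Im a" for y
  proof -
    have "continuous_on {-R..R} (\<lambda>x. 1 / (a - Complex x y))"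
      unfolding Complex_eq using y by (intro continuous_intros) (auto simp: complex_eq_iff)
    then have "set_integrable lborel {-R..R} (\<lambda>x. 1 / (a - Complex x y))"
      by (rule borel_integrable_atLeastAtMost')
    then have "(LINT x:{-R..R}|lborel. 1 / (a - Complex x y)) = E y"
      using integral_Cauchy_kernel_line[OF assms(1) y]
      by (simp add: set_borel_integral_eq_integral(2) integral_unique E_def L_def)
    moreover have "(\<integral>x. indicator (square R) (Complex x y) *\<^sub>R (1 / (a - Complex x y)) \<partial>lborel) =
      indicator {-R..R} y *\<^sub>R (LINT x:{-R..R}|lborel. 1 / (a - Complex x y))"
      unfolding set_lebesgue_integral_def integral_scaleR_right[symmetric]
      by (intro Bochner_Integration.integral_cong) (auto simp: indicator_def square_iff_Complex)
    ultimately show ?thesis by simp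
  qed
  have "(\<integral>u. indicator (square R) u *\<^sub>R (1 / (a - u)) \<partial>lborel) =
      (\<integral>y. \<integral>x. indicator (square R) (Complex x y) *\<^sub>R (1 / (a - Complex x y)) \<partial>lborel \<partial>lborel)"
    using assms by (intro integral_lborel_complex integrable_Cauchy_kernel) (auto simp: square_def)
  also have "\<dots> = (LINT y:{-R..R}|lborel. E y)"
    unfolding set_lebesgue_integral_def
  proof (rule integral_cong_AE)
    have [measurable]: "(\<lambda>y. indicator {-R..R} y *\<^sub>R E y) \<in> borel_measurable borel"
      using set_integral_diff(1)[OF intL int_sgn'] by (simp add: E_def set_integrable_def)
    show "(\<lambda>y. indicator {-R..R} y *\<^sub>R E y) \<in> borel_measurable lborel"
      by simp
    show "(\<lambda>y. \<integral>x. indicator (square R) (Complex x y) *\<^sub>R (1 / (a - Complex x y)) \<partial>lborel)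
      \<in> borel_measurable lborel"
      unfolding Complex_eq by measurable
    show "AE y in lborel. (\<integral>x. indicator (square R) (Complex x y) *\<^sub>R (1 / (a - Complex x y)) \<partial>lborel) =
      indicator {-R..R} y *\<^sub>R E y"
      using AE_lborel_singleton[of "Im a"] by eventually_elim (rule line)
  qed
  also have "\<dots> = (LINT y:{-R..R}|lborel. L y) - (LINT y:{-R..R}|lborel. \<i> * pi * complex_of_real (sgn (Im a - y)))"
    unfolding E_def using intL int_sgn' by (rule set_integral_diff)
  also have "(LINT y:{-R..R}|lborel. \<i> * pi * complex_of_real (sgn (Im a - y))) =
      \<i> * pi * (LINT y:{-R..R}|lborel. sgn (Im a - y))"
    by (simp add: set_integral_complex_of_real)
  also have "(LINT y:{-R..R}|lborel. sgn (Im a - y)) = 2 * Im a"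
    using has_integral_sgn[OF assms(2)] int_sgn by (simp add: set_borel_integral_eq_integral(2) integral_unique)
  also have "(LINT y:{-R..R}|lborel. L y) = integral {-R..R} L"
    using intL by (rule set_borel_integral_eq_integral(2))
  finally show ?thesis
    unfolding L_def by simp
qed

text \<open>
  The area is the integral of the winding number, that is of \<open>g'(s) / (2\<pi>\<i> (g(s) - u))\<close> over \<open>s\<close> and \<open>u\<close>.
  By Fubini the integration over \<open>u\<close> may be done first; the logarithms it produces are holomorphic
  along the curve and integrate to zero, so that only the jump term \<open>Im (g s)\<close> survives.
\<close>

lemma measure_inside_closed_curve:
  fixes g g' :: "real \<Rightarrow> complex"
  assumes deriv: "\<And>x. (g has_vector_derivative g' x) (at x)"
    and cont': "continuous_on UNIV g'" and closed: "g 1 = g 0"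
    and wn: "\<And>u. u \<in> inside (path_image g) \<Longrightarrow> winding_number g u = 1"
  shows "of_real (measure lebesgue (inside (path_image g))) = - integral {0..1} (\<lambda>x. Im (g x) * g' x)"
proof -
  have cont: "continuous_on S g" for S
    using deriv by (meson continuous_at_imp_continuous_on has_vector_derivative_continuous)
  have [measurable]: "g \<in> borel_measurable borel" "g' \<in> borel_measurable borel"
    using cont cont' by (auto intro: borel_measurable_continuous_onI)
  define K where "K = path_image g"
  have path: "path g"
    using cont by (simp add: path_def)
  have vp: "valid_path g"
    unfolding valid_path_def
  proof (rule C1_differentiable_imp_piecewise)
    show "g C1_differentiable_on {0..1}"
      unfolding C1_differentiable_on_def using deriv cont' continuous_on_subset by blast
  qed
  have "compact K"
    unfolding K_def using path by (rule compact_path_image)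
  then obtain R0 where R0: "\<And>z. z \<in> K \<Longrightarrow> norm z \<le> R0"
    using compact_imp_bounded bounded_iff by metis
  \<comment> \<open>The added 1 keeps the curve in the open square, so that the logarithms below
    have arguments in the right half plane.\<close>
  define R where "R = \<bar>R0\<bar> + 1"
  have KR: "\<bar>Re z\<bar> < R" "\<bar>Im z\<bar> < R" if "z \<in> K" for z
    using R0[OF that] abs_Re_le_cmod[of z] abs_Im_le_cmod[of z] unfolding R_def by linarith+
  have gK: "g s \<in> K" if "s \<in> {0..1}" for s
    using that by (auto simp: K_def path_image_def)
  have Ksq: "K \<subseteq> square R"
    using KR by (auto simp: square_def intro: less_imp_le)
  have "convex (square R)"
  proof -
    have "square R = Re -` {-R..R} \<inter> Im -` {-R..R}"
      by (auto simp: square_def)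
    then show ?thesis
      by (auto intro!: convex_Int convex_linear_vimage linearI)
  qed
  then have inside_sq: "inside K \<subseteq> square R"
    using outside_subset_convex[OF _ Ksq] inside_Int_outside[of K] by blast
  have open_inside: "open (inside K)"
    using \<open>compact K\<close> by (intro open_inside compact_imp_closed)
  then have [measurable]: "inside K \<in> sets borel"
    by simp

  define F where "F = (\<lambda>s u. indicator {0..1} s *\<^sub>R (indicator (square R) u *\<^sub>R (g' s / (g s - u))))"
  have [measurable]: "case_prod F \<in> borel_measurable (borel \<Otimes>\<^sub>M borel)"
    unfolding F_def by measurable
  obtain B where B: "\<And>s. s \<in> {0..1} \<Longrightarrow> norm (g' s) \<le> B"
    using compact_continuous_image[OF continuous_on_subset[OF cont', of "{0..1}"]]
    by (metis bounded_iff compact_Icc compact_imp_bounded imageI subset_UNIV)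
  obtain C where C: "C < \<infinity>"
    "\<And>a. a \<in> square R \<Longrightarrow> (\<integral>\<^sup>+ u. ennreal (indicator (square R) u * (1 / norm (a - u))) \<partial>lborel) \<le> C"
    using Cauchy_kernel_bound by blast
  \<comment> \<open>Absolute integrability for Fubini: \<open>g'\<close> is bounded on the unit
    interval and the kernel integral is bounded uniformly in the pole \<open>g s\<close>.\<close>
  have "integrable (lborel \<Otimes>\<^sub>M lborel) (case_prod F)"
  proof (rule integrableI_bounded)
    have "(\<integral>\<^sup>+ p. norm (case_prod F p) \<partial>(lborel \<Otimes>\<^sub>M lborel)) = (\<integral>\<^sup>+ s. \<integral>\<^sup>+ u. norm (F s u) \<partial>lborel \<partial>lborel)"
      by (subst lborel.nn_integral_fst[symmetric]) auto
    also have "\<dots> \<le> (\<integral>\<^sup>+ s. (ennreal B * C) * indicator {0..1::real} s \<partial>lborel)"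
    proof (rule nn_integral_mono)
      fix s :: real
      show "(\<integral>\<^sup>+ u. norm (F s u) \<partial>lborel) \<le> (ennreal B * C) * indicator {0..1} s"
      proof (cases "s \<in> {0..1}")
        case True
        have B0: "0 \<le> B" using B[OF True] norm_ge_zero order_trans by blast
        have "(\<integral>\<^sup>+ u. norm (F s u) \<partial>lborel) \<le>
            (\<integral>\<^sup>+ u. ennreal B * ennreal (indicator (square R) u * (1 / norm (g s - u))) \<partial>lborel)"
        proof (rule nn_integral_mono)
          fix u
          have "norm (F s u) = norm (g' s) * (indicator (square R) u * (1 / norm (g s - u)))"
            using True by (simp add: F_def norm_divide norm_mult)
          also have "\<dots> \<le> B * (indicator (square R) u * (1 / norm (g s - u)))"
            using B[OF True] by (intro mult_right_mono) auto
          finally show "ennreal (norm (F s u)) \<le> ennreal B * ennreal (indicator (square R) u * (1 / norm (g s - u)))"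
            using B0 by (simp add: ennreal_leI ennreal_mult[symmetric])
        qed
        also have "\<dots> = ennreal B * (\<integral>\<^sup>+ u. ennreal (indicator (square R) u * (1 / norm (g s - u))) \<partial>lborel)"
          by (rule nn_integral_cmult) measurable
        also have "\<dots> \<le> ennreal B * C"
          using C(2)[of "g s"] Ksq gK[OF True] by (intro mult_left_mono) auto
        finally show ?thesis using True by simp
      qed (simp add: F_def)
    qed
    also have "\<dots> = (ennreal B * C)"
      by (subst nn_integral_cmult_indicator) auto
    also have "\<dots> < \<infinity>"
      using C(1) by (simp add: ennreal_mult_less_top)
    finally show "(\<integral>\<^sup>+ p. norm (case_prod F p) \<partial>(lborel \<Otimes>\<^sub>M lborel)) < \<infinity>" .
  qed simp
  note Fubini = lborel_pair.Fubini_integral[OF this]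

  \<comment> \<open>The winding number integral is available only off the curve, which is a null set
    as a differentiable image of an interval.\<close>
  have nullK: "AE u in lborel. u \<notin> K"
  proof -
    have "g differentiable_on {0..1}"
      using deriv by (meson differentiableI_vector differentiable_at_imp_differentiable_on)
    then have "negligible K"
      unfolding K_def path_image_def by (rule negligible_differentiable_image_lowdim[rotated]) simp
    then have "K \<in> null_sets lborel"
      using \<open>compact K\<close> by (auto simp: negligible_iff_null_sets null_sets_def compact_imp_closed)
    then show ?thesis
      by (rule AE_not_in)
  qed
  have inner: "(\<integral>s. F s u \<partial>lborel) = 2 * pi * \<i> * indicator (inside K) u" if u: "u \<notin> K" for u
  proof (cases "u \<in> square R")
    case True
    have cF: "continuous_on {0..1} (\<lambda>s. g' s / (g s - u))"
      using u gK by (intro continuous_intros cont continuous_on_subset[OF cont']) auto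
    have "(\<integral>s. F s u \<partial>lborel) = (LINT s:{0..1}|lborel. g' s / (g s - u))"
      using True by (simp add: F_def set_lebesgue_integral_def)
    also have "\<dots> = integral {0..1} (\<lambda>s. g' s / (g s - u))"
      by (intro set_borel_integral_eq_integral(2) borel_integrable_atLeastAtMost' cF)
    also have "\<dots> = contour_integral g (\<lambda>w. 1 / (w - u))"
      unfolding contour_integral_integral by (simp add: vector_derivative_at[OF deriv])
    also have "\<dots> = 2 * pi * \<i> * winding_number g u"
      using winding_number_valid_path[OF vp] u by (simp add: K_def)
    finally have "(\<integral>s. F s u \<partial>lborel) = 2 * pi * \<i> * winding_number g u" .
    moreover have "u \<in> inside K \<or> u \<in> outside K"
      using u inside_Un_outside[of K] by blast
    then have "winding_number g u = indicator (inside K) u"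
      using wn[of u] winding_number_zero_in_outside[OF path, of u] closed
      by (auto simp: K_def pathfinish_def pathstart_def indicator_def)
    ultimately show ?thesis by simp
  next
    case False
    then show ?thesis
      using inside_sq by (auto simp: F_def indicator_def)
  qed
  define L where "L = (\<lambda>(a::complex) (y::real). Ln (a - \<i> * y + R) - Ln (R - a + \<i> * y))"
  have np: "g s - \<i> * y + R \<notin> \<real>\<^sub>\<le>\<^sub>0" "R - g s + \<i> * y \<notin> \<real>\<^sub>\<le>\<^sub>0" if "s \<in> {0..1}" for s and y :: real
    using KR(1)[OF gK[OF that]] by (auto simp: complex_nonpos_Reals_iff)
  have cLp: "continuous_on ({0..1} \<times> cbox (-R) R) (\<lambda>(s, y). g' s * L (g s) y)"
    unfolding L_def split_beta
    by (intro continuous_intros continuous_on_compose2[OF cont] continuous_on_compose2[OF cont'])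
       (use np in auto)
  have "cbox (0::real, -R) (1, R) = {0..1} \<times> cbox (-R) R"
    by (simp add: cbox_Pair_eq)
  then have cL: "continuous_on (cbox (0, -R) (1, R)) (\<lambda>(s, y). g' s * L (g s) y)"
    using cLp by (simp only:)
  have cL1: "continuous_on {0..1} (\<lambda>s. integral {-R..R} (\<lambda>y. g' s * L (g s) y))"
    using integral_continuous_on_param[OF cLp] unfolding cbox_interval .
  \<comment> \<open>For fixed \<open>y\<close> the function \<open>L a y\<close> has the primitive
    \<open>\<Psi>\<close> in \<open>a\<close>, built from \<open>v * Ln v - v\<close>, so its
    integral along the closed curve vanishes.\<close>
  have primitive: "integral {0..1} (\<lambda>s. g' s * L (g s) y) = 0" for y
  proof -
    define \<Phi> :: "complex \<Rightarrow> complex" where "\<Phi> = (\<lambda>v. v * Ln v - v)"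
    have \<Phi>: "(\<Phi> has_field_derivative Ln v) (at v)" if "Re v > 0" for v
    proof -
      have "v \<noteq> 0" "v \<notin> \<real>\<^sub>\<le>\<^sub>0" using that by (auto simp: complex_nonpos_Reals_iff)
      then show ?thesis unfolding \<Phi>_def by (auto intro!: derivative_eq_intros)
    qed
    define \<Psi> where "\<Psi> = (\<lambda>a::complex. \<Phi> (a - \<i> * y + R) + \<Phi> (R - a + \<i> * y))"
    have \<Psi>: "(\<Psi> has_field_derivative L a y) (at a)" if "\<bar>Re a\<bar> < R" for a
    proof -
      have "((\<lambda>a. \<Phi> (a - \<i> * y + R)) has_field_derivative Ln (a - \<i> * y + R) * 1) (at a)"
        by (rule DERIV_chain2[OF \<Phi>]) (use that in \<open>auto intro!: derivative_eq_intros\<close>)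
      moreover have "((\<lambda>a. \<Phi> (R - a + \<i> * y)) has_field_derivative Ln (R - a + \<i> * y) * (-1)) (at a)"
        by (rule DERIV_chain2[OF \<Phi>]) (use that in \<open>auto intro!: derivative_eq_intros\<close>)
      ultimately show ?thesis
        unfolding \<Psi>_def L_def by (auto dest: DERIV_add)
    qed
    have "((\<Psi> \<circ> g) has_vector_derivative g' s * L (g s) y) (at s within {0..1})" if "s \<in> {0..1}" for s
      by (rule has_vector_derivative_at_within, rule field_vector_diff_chain_at[OF deriv \<Psi>])
         (rule KR(1)[OF gK[OF that]])
    from integral_unique[OF fundamental_theorem_of_calculus[OF _ this]] show ?thesis
      using closed by simp
  qed
  have slice: "(\<integral>u. F s u \<partial>lborel) = indicator {0..1} s *\<^sub>R
      (integral {-R..R} (\<lambda>y. g' s * L (g s) y) - 2 * \<i> * pi * (Im (g s) * g' s))" for s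
  proof (cases "s \<in> {0..1}")
    case True
    have "(\<integral>u. F s u \<partial>lborel) = (\<integral>u. g' s * (indicator (square R) u *\<^sub>R (1 / (g s - u))) \<partial>lborel)"
      using True by (simp add: F_def)
    also have "\<dots> = g' s * (\<integral>u. (indicator (square R) u *\<^sub>R (1 / (g s - u))) \<partial>lborel)"
      by (rule integral_mult_right_zero)
    also have "\<dots> = g' s * (integral {-R..R} (L (g s)) - 2 * \<i> * pi * Im (g s))"
      using KR[OF gK[OF True]] by (simp add: integral_Cauchy_kernel_square L_def)
    finally show ?thesis
      using True by (simp add: algebra_simps)
  qed (simp add: F_def)
  have c2: "continuous_on {0..1} (\<lambda>s. 2 * \<i> * pi * (Im (g s) * g' s))"
    by (intro continuous_intros cont continuous_on_subset[OF cont']) auto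
  have "of_real (measure lebesgue (inside K)) = (\<integral>u. complex_of_real (indicator (inside K) u) \<partial>lborel)"
    by (subst integral_complex_of_real) (simp add: measure_completion del: integral_complex_of_real)
  also have "\<dots> = (\<integral>u. indicator (inside K) u \<partial>lborel)"
    by (intro Bochner_Integration.integral_cong) (auto simp: indicator_def)
  finally have "2 * pi * \<i> * of_real (measure lebesgue (inside K)) =
      2 * pi * \<i> * (\<integral>u. indicator (inside K) u \<partial>lborel)"
    by simp
  also have "\<dots> = (\<integral>u. 2 * pi * \<i> * indicator (inside K) u \<partial>lborel)"
    by (rule integral_mult_right_zero[symmetric])
  also have "\<dots> = (\<integral>u. \<integral>s. F s u \<partial>lborel \<partial>lborel)"
  proof (rule integral_cong_AE)
    show "AE u in lborel. 2 * pi * \<i> * indicator (inside K) u = (\<integral>s. F s u \<partial>lborel)"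
      using nullK by eventually_elim (rule inner[symmetric])
  qed measurable
  also have "\<dots> = (\<integral>s. \<integral>u. F s u \<partial>lborel \<partial>lborel)"
    by (rule Fubini)
  also have "\<dots> = (LINT s:{0..1}|lborel. integral {-R..R} (\<lambda>y. g' s * L (g s) y) - 2 * \<i> * pi * (Im (g s) * g' s))"
    unfolding slice set_lebesgue_integral_def ..
  also have "\<dots> = integral {0..1} (\<lambda>s. integral {-R..R} (\<lambda>y. g' s * L (g s) y) - 2 * \<i> * pi * (Im (g s) * g' s))"
    by (intro set_borel_integral_eq_integral(2) borel_integrable_atLeastAtMost' continuous_on_diff cL1 c2)
  also have "\<dots> = integral {0..1} (\<lambda>s. integral {-R..R} (\<lambda>y. g' s * L (g s) y)) -
      integral {0..1} (\<lambda>s. 2 * \<i> * pi * (Im (g s) * g' s))"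
    by (intro integral_diff integrable_continuous_real cL1 c2)
  \<comment> \<open>A second exchange, now of continuous integrands, puts the integral along the
    curve innermost so that \<open>primitive\<close> applies.\<close>
  also have "integral {0..1} (\<lambda>s. integral {-R..R} (\<lambda>y. g' s * L (g s) y)) =
      integral {-R..R} (\<lambda>y. integral {0..1} (\<lambda>s. g' s * L (g s) y))"
    using integral_swap_continuous[OF cL] unfolding cbox_interval .
  also have "\<dots> = 0"
    by (simp only: primitive Henstock_Kurzweil_Integration.integral_0)
  also have "integral {0..1} (\<lambda>s. 2 * \<i> * pi * (Im (g s) * g' s)) =
      2 * \<i> * pi * integral {0..1} (\<lambda>s. Im (g s) * g' s)"
    by (rule integral_mult_right)
  finally have "2 * pi * \<i> * of_real (measure lebesgue (inside K)) =
      2 * pi * \<i> * - integral {0..1} (\<lambda>s. Im (g s) * g' s)"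
    unfolding of_real_mult of_real_numeral by algebra
  then show ?thesis
    unfolding K_def by (subst (asm) mult_cancel_left) (simp only: mult_eq_0_iff, simp)
qed

section \<open>Laurent polynomials on the punctured plane\<close>

text \<open>
  A curve \<open>(r, p)\<close> is encoded by the polynomial \<open>q = r + u p(u)\<close> in \<open>u = 1/w\<close>; then \<open>z = zpol q\<close>, the
  function \<open>z\<^sup>~\<close> is \<open>tilde (zpol q)\<close>, and \<open>w \<partial>z/\<partial>w = zpol (euler q)\<close>.
\<close>

definition zpol :: "complex poly \<Rightarrow> complex \<Rightarrow> complex" where
  "zpol q w = w * poly q (inverse w)"

definition tilde :: "(complex \<Rightarrow> complex) \<Rightarrow> complex \<Rightarrow> complex" where
  "tilde f w = cnj (f (inverse (cnj w)))"

definition euler :: "complex poly \<Rightarrow> complex poly" where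
  "euler q = q - pCons 0 (pderiv q)"

text \<open>
  If \<open>f(w) = w\<^sup>k P(1/w)\<close>, then \<open>hpos k P\<close> is the part of \<open>f\<close> with positive powers and \<open>coeff P k\<close> its constant
  term; thus \<open>M\<^sub>k = hpart k (q\<^sup>k)\<close>.
\<close>

definition hpos :: "nat \<Rightarrow> complex poly \<Rightarrow> complex \<Rightarrow> complex" where
  "hpos k P w = (\<Sum>i<k. coeff P i * w ^ (k - i))"

definition hpart :: "nat \<Rightarrow> complex poly \<Rightarrow> complex \<Rightarrow> complex" where
  "hpart k P w = hpos k P w + coeff P k / 2"

lemma tilde_tilde [simp]: "tilde (tilde f) = f"
  by (simp add: tilde_def fun_eq_iff)

text \<open>\<open>tilde\<close> is reflection in the unit circle and exchanges infinity with 0; all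
  behaviour at 0 is obtained from infinity in this way.\<close>

lemma tilde_tendsto_at_0:
  assumes "(f \<longlongrightarrow> l) at_infinity"
  shows "(tilde f \<longlongrightarrow> cnj l) (at 0)"
proof -
  have "filterlim (\<lambda>w::complex. inverse (cnj w)) at_infinity (at 0)"
    by (rule filterlim_compose[OF filterlim_inverse_at_infinity])
       (auto simp: filterlim_at eventually_at_filter intro!: tendsto_eq_intros)
  from tendsto_cnj[OF filterlim_compose[OF assms this]] show ?thesis
    by (simp add: tilde_def[abs_def])
qed

lemma holomorphic_zpol: "zpol q holomorphic_on - {0}"
  unfolding zpol_def[abs_def] by (intro holomorphic_intros) auto

lemma tilde_zpol: "tilde (zpol q) w = inverse w * poly (map_poly cnj q) w"
  by (simp add: tilde_def zpol_def)

lemma holomorphic_tilde_zpol: "tilde (zpol q) holomorphic_on - {0}"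
  unfolding tilde_zpol[abs_def] by (intro holomorphic_intros) auto

lemma holomorphic_hpos: "hpos k P holomorphic_on S"
  unfolding hpos_def[abs_def] by (intro holomorphic_intros)

lemma eventually_nonzero_at_infinity: "eventually (\<lambda>w::complex. w \<noteq> 0) at_infinity"
  unfolding eventually_at_infinity by (intro exI[of _ 1]) auto

text \<open>Remove the singularity at 0 and apply Liouville. The equality of the two limits matters
  by itself: in \<open>Lax_equations\<close> it determines an unknown constant.\<close>

lemma holomorphic_punctured_plane_const:
  assumes "f holomorphic_on - {0}" "(f \<longlongrightarrow> \<alpha>) at_infinity" "(f \<longlongrightarrow> \<beta>) (at 0)"
  shows "\<alpha> = \<beta>" "w \<noteq> 0 \<Longrightarrow> f w = \<alpha>"
proof -
  define F where "F = f(0 := \<beta>)"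
  have F: "F holomorphic_on - {0}"
    using assms(1) by (rule holomorphic_transform) (auto simp: F_def)
  have "isCont F x" for x
  proof (cases "x = 0")
    case True
    have "(F \<longlongrightarrow> \<beta>) (at 0)"
      using assms(3) by (rule Lim_transform_eventually) (auto simp: F_def eventually_at_filter)
    then show ?thesis by (simp add: isCont_def True F_def)
  next
    case False
    then show ?thesis
      using holomorphic_on_imp_continuous_on[OF F] by (simp add: continuous_on_eq_continuous_at open_Compl)
  qed
  then have "F holomorphic_on UNIV"
    using F by (intro no_isolated_singularity[of UNIV F "{0}"]) (auto simp: continuous_at_imp_continuous_on Compl_eq_Diff_UNIV)
  moreover have "(F \<longlongrightarrow> \<alpha>) at_infinity"
    using assms(2) eventually_mono[OF eventually_nonzero_at_infinity]
    by (rule Lim_transform_eventually) (simp add: F_def)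
  ultimately have "F z = \<alpha>" for z
    by (rule Liouville_weak)
  from this[of 0] this[of w] show "\<alpha> = \<beta>" "w \<noteq> 0 \<Longrightarrow> f w = \<alpha>"
    by (auto simp: F_def)
qed

lemma poly_inverse_tendsto:
  fixes q :: "complex poly"
  shows "((\<lambda>w. poly q (inverse w)) \<longlongrightarrow> coeff q 0) at_infinity"
  using isCont_tendsto_compose[OF poly_isCont tendsto_inverse_0, of q] by (simp add: poly_0_coeff_0)

lemma hpos_Suc: "hpos (Suc k) (pCons c Q) w = c * w ^ Suc k + hpos k Q w"
  by (simp add: hpos_def sum.lessThan_Suc_shift del: sum.lessThan_Suc)

text \<open>Without its positive powers a Laurent polynomial tends to its constant term. The
  induction removes the leading coefficient \<open>c\<close>, which carries
  \<open>w ^ Suc k\<close>.\<close>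

lemma Laurent_minus_hpos_tendsto:
  "((\<lambda>w. w ^ k * poly P (inverse w) - hpos k P w) \<longlongrightarrow> coeff P k) at_infinity"
proof (induction k arbitrary: P)
  case 0
  then show ?case using poly_inverse_tendsto[of P] by (simp add: hpos_def)
next
  case (Suc k)
  obtain c Q where P: "P = pCons c Q" by (cases P)
  have "((\<lambda>w. w ^ Suc k * poly P (inverse w) - hpos (Suc k) P w) \<longlongrightarrow> coeff Q k) at_infinity"
    by (rule Lim_transform_eventually[OF Suc.IH[of Q] eventually_mono[OF eventually_nonzero_at_infinity]])
       (simp add: P hpos_Suc field_simps)
  then show ?case by (simp add: P)
qed

lemma hpos_tendsto_0: "(hpos k P \<longlongrightarrow> 0) (at 0)"
proof -
  have "isCont (hpos k P) 0"
    unfolding hpos_def[abs_def] by (intro continuous_intros)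
  moreover have "hpos k P 0 = 0"
    by (auto simp: hpos_def intro!: sum.neutral)
  ultimately show ?thesis by (simp add: isCont_def)
qed

text \<open>Both sides are the polynomial in \<open>1/w\<close> of
  \<open>w\<^sup>-\<^sup>k \<theta>(z\<^sup>k)\<close>: the left by the chain rule, the right
  because \<open>\<theta>\<close> acts on functions of \<open>u = 1/w\<close> as
  \<open>- u d/du\<close>.\<close>

lemma euler_power:
  "smult (of_nat k) (q ^ (k - 1) * euler q) = smult (of_nat k) (q ^ k) - pCons 0 (pderiv (q ^ k))"
proof (cases k)
  case (Suc n)
  then show ?thesis
    by (simp only: pderiv_power_Suc) (simp add: euler_def algebra_simps smult_diff_right)
qed simp

lemma zpol_ratio_tendsto:
  assumes "coeff q 0 \<noteq> 0"
  shows "((\<lambda>w. zpol p w / zpol q w) \<longlongrightarrow> coeff p 0 / coeff q 0) at_infinity"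
proof -
  have "((\<lambda>w. poly p (inverse w) / poly q (inverse w)) \<longlongrightarrow> coeff p 0 / coeff q 0) at_infinity"
    by (intro tendsto_divide poly_inverse_tendsto assms)
  then show ?thesis
    by (rule Lim_transform_eventually[OF _ eventually_mono[OF eventually_nonzero_at_infinity]])
       (simp add: zpol_def)
qed

lemma zpol_eventually_nonzero:
  assumes "coeff q 0 \<noteq> 0"
  shows "eventually (\<lambda>w. zpol q w \<noteq> 0) at_infinity"
proof -
  have "eventually (\<lambda>w. poly q (inverse w) \<noteq> 0) at_infinity"
    using tendsto_imp_eventually_ne[OF poly_inverse_tendsto assms] .
  then show ?thesis
    using eventually_nonzero_at_infinity by eventually_elim (simp add: zpol_def)
qed

text \<open>
  For a derivation with \<open>\<partial>z = zpol a\<close> and \<open>\<partial>z\<^sup>~ = tilde (zpol b)\<close>, \<open>pairing q a b\<close> is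
  \<open>\<theta>z \<partial>z\<^sup>~ - \<theta>z\<^sup>~ \<partial>z\<close>.  For a real direction \<open>a = b\<close>; for a Wirtinger derivative they differ, and the
  conjugate derivative swaps them.
\<close>

definition pairing :: "complex poly \<Rightarrow> complex poly \<Rightarrow> complex poly \<Rightarrow> complex \<Rightarrow> complex" where
  "pairing q a b w = zpol (euler q) w * tilde (zpol b) w + tilde (zpol (euler q)) w * zpol a w"

section \<open>String equation and Lax equations from the behaviour at infinity\<close>

lemma tilde_pairing: "tilde (pairing q a b) w = pairing q b a w"
  by (simp add: pairing_def tilde_def)

lemma holomorphic_pairing: "pairing q a b holomorphic_on - {0}"
  unfolding pairing_def[abs_def] by (intro holomorphic_intros holomorphic_zpol holomorphic_tilde_zpol)

text \<open>Since \<open>\<theta>z\<^sup>~ = - tilde (zpol (euler q))\<close>, the pairing is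
  written with a plus sign and is invariant under \<open>tilde\<close> when both polynomials agree.
  Its limit at 0 is thus the conjugate of that at infinity, and Liouville applies.\<close>

lemma string_equation:
  assumes "(pairing q p p \<longlongrightarrow> 1) at_infinity" "w \<noteq> 0"
  shows "pairing q p p w = 1"
proof -
  have "(tilde (pairing q p p) \<longlongrightarrow> cnj 1) (at 0)"
    using assms(1) by (rule tilde_tendsto_at_0)
  then have "(pairing q p p \<longlongrightarrow> 1) (at 0)"
    by (simp add: tilde_pairing[abs_def])
  from holomorphic_punctured_plane_const(2)[OF holomorphic_pairing assms(1) this assms(2)] show ?thesis .
qed

text \<open>The factor is the exponent \<open>k - i\<close> of \<open>w\<close> brought down by
  \<open>\<theta>\<close>; it kills the constant term, at \<open>i = k\<close>.\<close>

lemma coeff_euler_power: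
  "coeff (smult (of_nat k) (q ^ (k - 1) * euler q)) i = (of_nat k - of_nat i) * coeff (q ^ k) i"
  unfolding euler_power by (cases i) (auto simp: coeff_pderiv algebra_simps)

lemma zpol_power_mult: "k \<ge> 1 \<Longrightarrow> zpol q w ^ (k - 1) * zpol p w = w ^ k * poly (q ^ (k - 1) * p) (inverse w)"
  by (cases k) (auto simp: zpol_def poly_power power_mult_distrib)

text \<open>At infinity the pairing agrees with \<open>\<theta>(z\<^sup>k)\<close>, which has no
  constant term, so subtracting the positive part leaves a function tending to 0. At 0 the pairing
  is the reflection of the swapped one, which tends to 0 by \<open>inf'\<close>, and positive powers
  vanish there.\<close>

lemma pairing_eq_hpos:
  assumes k: "k \<ge> 1"
    and inf: "((\<lambda>w. pairing q a b w - of_nat k * zpol q w ^ (k - 1) * zpol (euler q) w) \<longlongrightarrow> 0) at_infinity"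
    and inf': "(pairing q b a \<longlongrightarrow> 0) at_infinity" and w: "w \<noteq> 0"
  shows "pairing q a b w = hpos k (smult (of_nat k) (q ^ (k - 1) * euler q)) w"
proof -
  let ?P = "smult (of_nat k) (q ^ (k - 1) * euler q)"
  define f where "f = (\<lambda>w. pairing q a b w - hpos k ?P w)"
  have "((\<lambda>w. w ^ k * poly ?P (inverse w) - hpos k ?P w) \<longlongrightarrow> 0) at_infinity"
    using Laurent_minus_hpos_tendsto[of k ?P] unfolding coeff_euler_power by simp
  from tendsto_add[OF inf this] have "(f \<longlongrightarrow> 0) at_infinity"
    using zpol_power_mult[OF k, of q _ "euler q"] by (simp add: f_def[abs_def] algebra_simps)
  moreover have "(f \<longlongrightarrow> 0) (at 0)"
    using tendsto_diff[OF tilde_tendsto_at_0[OF inf'] hpos_tendsto_0[of k ?P]]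
    by (simp add: tilde_pairing[abs_def] f_def[abs_def])
  moreover have "f holomorphic_on - {0}"
    unfolding f_def by (intro holomorphic_intros holomorphic_pairing holomorphic_hpos)
  ultimately have "f w = 0"
    using holomorphic_punctured_plane_const(2)[of f] w by blast
  then show ?thesis by (simp add: f_def)
qed

text \<open>Here \<open>M\<close> and \<open>D\<close> stand for \<open>\<theta>M\<^sub>k\<close>
  and \<open>\<partial>\<^sub>0M\<^sub>k\<close>. The string equation and
  \<open>pairing q a b = M\<close> are linear relations from which \<open>a\<close> and
  \<open>b\<close> are recovered once \<open>lam = - D\<close> is known.\<close>

lemma Lax_equations:
  fixes q p a b :: "complex poly" and k :: nat
  defines "M \<equiv> hpos k (smult (of_nat k) (q ^ (k - 1) * euler q))"
    and "D \<equiv> hpart k (smult (of_nat k) (q ^ (k - 1) * p))"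
  assumes k: "k \<ge> 1"
    and q: "coeff q 0 \<noteq> 0" "cnj (coeff q 0) = coeff q 0"
    and ab: "coeff b 0 = cnj (coeff a 0)"
    and string: "(pairing q p p \<longlongrightarrow> 1) at_infinity"
    and inf: "((\<lambda>w. pairing q a b w - of_nat k * zpol q w ^ (k - 1) * zpol (euler q) w) \<longlongrightarrow> 0) at_infinity"
    and inf': "(pairing q b a \<longlongrightarrow> 0) at_infinity" and w: "w \<noteq> 0"
  shows "zpol a w = M w * zpol p w - D w * zpol (euler q) w"
    and "tilde (zpol b) w = M w * tilde (zpol p) w + D w * tilde (zpol (euler q)) w"
proof -
  define E where "E = zpol (euler q)"
  define lam where "lam = (\<lambda>w. zpol a w * tilde (zpol p) w - tilde (zpol b) w * zpol p w)"
  let ?P = "smult (of_nat k) (q ^ (k - 1) * p)"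
  have E0: "coeff (euler q) 0 = coeff q 0"
    by (simp add: euler_def)
  have st: "E w * tilde (zpol p) w + tilde E w * zpol p w = 1" if "w \<noteq> 0" for w
    using string_equation[OF string that] by (simp add: pairing_def E_def)
  have M: "E w * tilde (zpol b) w + tilde E w * zpol a w = M w" if "w \<noteq> 0" for w
    using pairing_eq_hpos[OF k inf inf' that] by (simp add: pairing_def E_def M_def)
  have nz: "eventually (\<lambda>w. E w \<noteq> 0) at_infinity" "eventually (\<lambda>w::complex. w \<noteq> 0) at_infinity"
    using zpol_eventually_nonzero[of "euler q"] q E0 eventually_nonzero_at_infinity unfolding E_def
    by simp_all
  have lim_p: "((\<lambda>w. zpol p w / E w) \<longlongrightarrow> coeff p 0 / coeff q 0) at_infinity"
    and lim_a: "((\<lambda>w. zpol a w / E w) \<longlongrightarrow> coeff a 0 / coeff q 0) at_infinity"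
    and lim_b: "((\<lambda>w. zpol b w / E w) \<longlongrightarrow> coeff b 0 / coeff q 0) at_infinity"
    using zpol_ratio_tendsto[of "euler q"] q E0 unfolding E_def by simp_all
  \<comment> \<open>Expansion of \<open>lam + D\<close> at infinity: by \<open>inf\<close> the
    pairing may be replaced by \<open>k z\<^sup>k\<^sup>-\<^sup>1 \<theta>z\<close>, and the
    positive powers of \<open>k z\<^sup>k\<^sup>-\<^sup>1 \<partial>\<^sub>0z\<close> then cancel
    against \<open>D\<close>, leaving half of its constant term.\<close>
  have "((\<lambda>w. zpol a w / E w - (pairing q a b w - of_nat k * zpol q w ^ (k - 1) * E w) * (zpol p w / E w) -
        (w ^ k * poly ?P (inverse w) - hpos k ?P w) + coeff ?P k / 2) \<longlongrightarrow>
      coeff a 0 / coeff q 0 - 0 * (coeff p 0 / coeff q 0) - coeff ?P k + coeff ?P k / 2) at_infinity"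
    using inf unfolding E_def[symmetric]
    by (intro tendsto_intros lim_a lim_p Laurent_minus_hpos_tendsto)
  then have "((\<lambda>w. lam w + D w) \<longlongrightarrow> coeff a 0 / coeff q 0 - 0 * (coeff p 0 / coeff q 0) - coeff ?P k + coeff ?P k / 2) at_infinity"
  proof (rule Lim_transform_eventually)
    show "\<forall>\<^sub>F w in at_infinity. zpol a w / E w - (pairing q a b w - of_nat k * zpol q w ^ (k - 1) * E w) * (zpol p w / E w) -
        (w ^ k * poly ?P (inverse w) - hpos k ?P w) + coeff ?P k / 2 = lam w + D w"
      using nz
    proof eventually_elim
      case (elim w)
      have "E w * lam w = zpol a w - pairing q a b w * zpol p w"
      proof -
        have "E w * lam w = zpol a w * (E w * tilde (zpol p) w + tilde E w * zpol p w) - pairing q a b w * zpol p w"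
          unfolding lam_def pairing_def E_def by (simp only: algebra_simps)
        then show ?thesis
          using st[OF elim(2)] by simp
      qed
      moreover have "lam w = E w * lam w / E w"
        using elim by simp
      ultimately have lam: "lam w = zpol a w / E w - pairing q a b w * (zpol p w / E w)"
        by (simp only: diff_divide_distrib times_divide_eq_right)
      have "of_nat k * zpol q w ^ (k - 1) * E w * (zpol p w / E w) = w ^ k * poly ?P (inverse w)"
        using elim zpol_power_mult[OF k, of q w p] by simp
      then show ?case
        unfolding D_def hpart_def left_diff_distrib lam by simp
    qed
  qed
  then have lim_inf: "((\<lambda>w. lam w + D w) \<longlongrightarrow> coeff a 0 / coeff q 0 - coeff ?P k / 2) at_infinity"
    by (simp add: algebra_simps)
  \<comment> \<open>The limit of \<open>lam\<close> at 0 is read off from \<open>tilde lam\<close>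
    at infinity, where the swapped pairing enters and tends to 0.\<close>
  have "((\<lambda>w. pairing q b a w * (zpol p w / E w) - zpol b w / E w) \<longlongrightarrow> 0 * (coeff p 0 / coeff q 0) - coeff b 0 / coeff q 0) at_infinity"
    by (intro tendsto_intros inf' lim_p lim_b)
  then have "(tilde lam \<longlongrightarrow> 0 * (coeff p 0 / coeff q 0) - coeff b 0 / coeff q 0) at_infinity"
  proof (rule Lim_transform_eventually)
    show "\<forall>\<^sub>F w in at_infinity. pairing q b a w * (zpol p w / E w) - zpol b w / E w = tilde lam w"
      using nz
    proof eventually_elim
      case (elim w)
      have "tilde lam w = tilde (zpol a) w * zpol p w - zpol b w * tilde (zpol p) w"
        by (simp add: lam_def tilde_def)
      then have "E w * tilde lam w = pairing q b a w * zpol p w - zpol b w"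
      proof -
        assume *: "tilde lam w = tilde (zpol a) w * zpol p w - zpol b w * tilde (zpol p) w"
        have "E w * tilde lam w = pairing q b a w * zpol p w - zpol b w * (E w * tilde (zpol p) w + tilde E w * zpol p w)"
          unfolding * pairing_def E_def by (simp only: algebra_simps)
        then show ?thesis
          using st[OF elim(2)] by simp
      qed
      moreover have "tilde lam w = E w * tilde lam w / E w"
        using elim by simp
      ultimately show ?case
        by (simp only: diff_divide_distrib times_divide_eq_right)
    qed
  qed
  from tilde_tendsto_at_0[OF this] have "(lam \<longlongrightarrow> - (coeff a 0 / coeff q 0)) (at 0)"
    by (simp add: ab q)
  moreover have "(D \<longlongrightarrow> 0 + coeff ?P k / 2) (at 0)"
    unfolding D_def hpart_def[abs_def] by (intro tendsto_intros hpos_tendsto_0)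
  ultimately have lim_0: "((\<lambda>w. lam w + D w) \<longlongrightarrow> - (coeff a 0 / coeff q 0) + (0 + coeff ?P k / 2)) (at 0)"
    by (rule tendsto_add)
  have "(\<lambda>w. lam w + D w) holomorphic_on - {0}"
    unfolding lam_def D_def hpart_def
    by (intro holomorphic_intros holomorphic_zpol holomorphic_tilde_zpol holomorphic_hpos)
  note const = holomorphic_punctured_plane_const[OF this lim_inf lim_0]
  \<comment> \<open>The limits at infinity and at 0 are \<open>x - c\<close> and
    \<open>- x + c\<close>, so their common value is 0. The weight 1/2 of the constant term in
    \<open>M\<^sub>k\<close> is what makes them opposite.\<close>
  define x c where "x = coeff a 0 / coeff q 0" and "c = coeff ?P k / 2"
  have "x - c = - x + (0 + c)"
    using const(1) by (simp only: x_def c_def)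
  then have "x - c = 0"
    by (simp add: field_simps)
  then have "lam w + D w = 0"
    using const(2)[OF w] by (simp only: x_def c_def)
  then have D: "D w = zpol p w * tilde (zpol b) w - tilde (zpol p) w * zpol a w"
    by (simp add: lam_def add_eq_0_iff algebra_simps)
  \<comment> \<open>Cramer's rule: the determinant of the system is 1 by the string
    equation.\<close>
  have "M w * zpol p w - D w * E w = zpol a w * (E w * tilde (zpol p) w + tilde E w * zpol p w)"
    unfolding D M[OF w, symmetric] by (simp only: algebra_simps)
  then show "zpol a w = M w * zpol p w - D w * zpol (euler q) w"
    using st[OF w] by (simp add: E_def)
  have "M w * tilde (zpol p) w + D w * tilde E w =
      tilde (zpol b) w * (E w * tilde (zpol p) w + tilde E w * zpol p w)"
    unfolding D M[OF w, symmetric] by (simp only: algebra_simps)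
  then show "tilde (zpol b) w = M w * tilde (zpol p) w + D w * tilde (zpol (euler q)) w"
    using st[OF w] by (simp add: E_def)
qed

section \<open>Circle averages and moments\<close>

definition avg :: "(complex \<Rightarrow> complex) \<Rightarrow> complex" where
  "avg f = integral {0..1} (\<lambda>x. f (cis (2 * pi * x)))"

lemma avg_cong: "(\<And>w. norm w = 1 \<Longrightarrow> f w = g w) \<Longrightarrow> avg f = avg g"
  unfolding avg_def by (intro integral_cong) simp

lemma norm_1_nonzero: "norm w = 1 \<Longrightarrow> w \<noteq> (0 :: complex)"
  by auto

lemma continuous_on_cis_circle:
  assumes "continuous_on (sphere 0 1) f"
  shows "continuous_on S (\<lambda>x. f (cis (2 * pi * x)))"
  by (rule continuous_on_compose2[OF assms]) (auto intro!: continuous_intros)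

lemma integrable_on_cis_circle:
  fixes f :: "complex \<Rightarrow> complex"
  assumes "continuous_on (sphere 0 1) f"
  shows "(\<lambda>x. f (cis (2 * pi * x))) integrable_on {0..1}"
  by (intro integrable_continuous_real continuous_on_cis_circle assms)

lemma avg_add:
  assumes "continuous_on (sphere 0 1) f" "continuous_on (sphere 0 1) g"
  shows "avg (\<lambda>w. f w + g w) = avg f + avg g"
  unfolding avg_def by (intro integral_add integrable_on_cis_circle assms)

lemma avg_diff:
  assumes "continuous_on (sphere 0 1) f" "continuous_on (sphere 0 1) g"
  shows "avg (\<lambda>w. f w - g w) = avg f - avg g"
  unfolding avg_def by (intro integral_diff integrable_on_cis_circle assms)

lemma avg_cmult: "avg (\<lambda>w. c * f w) = c * avg f"
  unfolding avg_def by (rule integral_mult_right)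

lemma has_vector_derivative_cis_circle:
  "((\<lambda>x. cis (2 * pi * x)) has_vector_derivative (2 * pi * \<i> * cis (2 * pi * x))) (at x within S)"
proof -
  have "((\<lambda>z. exp (2 * pi * \<i> * z)) has_field_derivative (2 * pi * \<i> * cis (2 * pi * x))) (at (of_real x))"
    by (auto intro!: derivative_eq_intros simp: cis_conv_exp mult_ac)
  from has_vector_derivative_real_field[OF this] show ?thesis
    by (simp add: cis_conv_exp mult_ac)
qed

text \<open>\<open>w * f' w\<close> is \<open>\<theta>f\<close>, up to a constant the derivative
  along the circle. This is the integration by parts rule for averages.\<close>

lemma avg_deriv_eq_0:
  assumes "\<And>w. norm w = 1 \<Longrightarrow> (f has_field_derivative f' w) (at w)"
  shows "avg (\<lambda>w. w * f' w) = 0"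
proof -
  have "((f \<circ> (\<lambda>x. cis (2 * pi * x))) has_vector_derivative
      (2 * pi * \<i> * cis (2 * pi * x)) * f' (cis (2 * pi * x))) (at x within {0..1})" for x
    by (rule field_vector_diff_chain_within[OF has_vector_derivative_cis_circle
          has_field_derivative_at_within[OF assms]]) simp
  from integral_unique[OF fundamental_theorem_of_calculus[OF _ this]]
  have "integral {0..1} (\<lambda>x. 2 * pi * \<i> * (cis (2 * pi * x) * f' (cis (2 * pi * x)))) = 0"
    by (simp add: mult.assoc)
  then show ?thesis
    unfolding avg_def by (simp only: integral_mult_right) simp
qed

lemma contour_integral_circlepath_avg:
  "contour_integral (circlepath 0 1) f = 2 * pi * \<i> * avg (\<lambda>w. w * f w)"
proof -
  have "circlepath 0 1 x = cis (2 * pi * x)" "exp (2 * of_real pi * \<i> * x) = cis (2 * pi * x)" for x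
    by (simp_all add: circlepath cis_conv_exp mult_ac)
  then have "contour_integral (circlepath 0 1) f =
      integral {0..1} (\<lambda>x. 2 * pi * \<i> * (cis (2 * pi * x) * f (cis (2 * pi * x))))"
    unfolding contour_integral_integral vector_derivative_circlepath by (simp add: mult_ac)
  then show ?thesis
    unfolding avg_def by (simp only: integral_mult_right)
qed

section \<open>Averages of functions holomorphic outside the circle\<close>

lemma avg_compose_inverse:
  assumes "continuous_on (sphere 0 1) f"
  shows "avg (\<lambda>w. f (inverse w)) = avg f"
proof -
  have "((\<lambda>x. f (cis (2 * pi * x))) has_integral avg f) (cbox 0 1)"
    using integrable_on_cis_circle[OF assms] by (simp add: avg_def has_integral_integral)
  from has_integral_affinity[OF this, of "-1" 1]
  have "((\<lambda>x. f (cis (2 * pi * (1 - x)))) has_integral avg f) {0..1}"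
    by (simp add: image_diff_atLeastAtMost)
  moreover have "cis (2 * pi * (1 - x)) = inverse (cis (2 * pi * x))" for x
  proof -
    have "cis (2 * pi * (1 - x)) = cis (2 * pi) * cis (- (2 * pi * x))"
      unfolding cis_mult by (simp add: algebra_simps)
    then show ?thesis by simp
  qed
  ultimately show ?thesis
    unfolding avg_def by (simp only: integral_unique)
qed

text \<open>Mean value property in the variable \<open>u = 1/w\<close>: the average is the value at
  \<open>w = \<infinity>\<close>.\<close>

lemma avg_inverse:
  assumes "G holomorphic_on T" "open T" "cball 0 1 \<subseteq> T"
  shows "avg (\<lambda>w. G (inverse w)) = G 0"
proof -
  have "((\<lambda>u. G u / (u - 0)) has_contour_integral (2 * of_real pi * \<i> * G 0)) (circlepath 0 1)"
    using assms by (intro Cauchy_integral_circlepath_simple) (auto intro: holomorphic_on_subset)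
  then have "avg (\<lambda>w. w * (G w / (w - 0))) = G 0"
    using contour_integral_circlepath_avg[of "\<lambda>u. G u / (u - 0)"] by (auto dest: contour_integral_unique)
  moreover have "avg (\<lambda>w. w * (G w / (w - 0))) = avg G"
    by (rule avg_cong) auto
  moreover have "continuous_on (sphere 0 1) G"
    using assms(3) sphere_cball
    by (intro holomorphic_on_imp_continuous_on holomorphic_on_subset[OF assms(1)]) blast
  ultimately show ?thesis
    using avg_compose_inverse[of G] by simp
qed

text \<open>In this form \<open>N\<close> bounds the pole order at infinity, the quantity on which
  the induction in \<open>Laurent_tendsto_0\<close> runs.\<close>

definition Laurent :: "(complex \<Rightarrow> complex) \<Rightarrow> bool" where
  "Laurent f \<longleftrightarrow> (\<exists>N Q. \<forall>w. w \<noteq> 0 \<longrightarrow> f w = w ^ N * poly Q (inverse w))"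

lemma LaurentI: "(\<And>w. w \<noteq> 0 \<Longrightarrow> f w = w ^ N * poly Q (inverse w)) \<Longrightarrow> Laurent f"
  unfolding Laurent_def by blast

lemma Laurent_add:
  assumes "Laurent f" "Laurent g"
  shows "Laurent (\<lambda>w. f w + g w)"
proof -
  obtain N Q M P where "\<And>w. w \<noteq> 0 \<Longrightarrow> f w = w ^ N * poly Q (inverse w)"
      "\<And>w. w \<noteq> 0 \<Longrightarrow> g w = w ^ M * poly P (inverse w)"
    using assms unfolding Laurent_def by blast
  then show ?thesis
    by (intro LaurentI[of _ "N + M" "monom 1 M * Q + monom 1 N * P"])
       (simp add: poly_monom power_add field_simps)
qed

lemma Laurent_mult:
  assumes "Laurent f" "Laurent g"
  shows "Laurent (\<lambda>w. f w * g w)"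
proof -
  obtain N Q M P where "\<And>w. w \<noteq> 0 \<Longrightarrow> f w = w ^ N * poly Q (inverse w)"
      "\<And>w. w \<noteq> 0 \<Longrightarrow> g w = w ^ M * poly P (inverse w)"
    using assms unfolding Laurent_def by blast
  then show ?thesis
    by (intro LaurentI[of _ "N + M" "Q * P"]) (simp add: power_add mult_ac)
qed

lemma Laurent_const: "Laurent (\<lambda>w. c)"
  by (rule LaurentI[of _ 0 "[:c:]"]) simp

lemma Laurent_diff: "Laurent f \<Longrightarrow> Laurent g \<Longrightarrow> Laurent (\<lambda>w. f w - g w)"
  using Laurent_add[of f "\<lambda>w. -1 * g w"] Laurent_mult[of "\<lambda>w. -1" g] Laurent_const[of "-1"] by simp

lemma Laurent_power: "Laurent f \<Longrightarrow> Laurent (\<lambda>w. f w ^ n)"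
  by (induction n) (auto intro: Laurent_const Laurent_mult)

lemma Laurent_zpol: "Laurent (zpol q)"
  by (rule LaurentI[of _ 1 q]) (simp add: zpol_def)

lemma Laurent_tilde_zpol: "Laurent (tilde (zpol q))"
  by (rule LaurentI[of _ "degree (map_poly cnj q)" "pCons 0 (reflect_poly (map_poly cnj q))"])
     (simp add: tilde_zpol poly_reflect_poly_nz power_inverse)

lemmas Laurent_intros = Laurent_add Laurent_mult Laurent_diff Laurent_power Laurent_const
  Laurent_zpol Laurent_tilde_zpol

lemma Laurent_pairing: "Laurent (pairing q a b)"
  unfolding pairing_def[abs_def] by (intro Laurent_intros)

lemma avg_inverse_rational:
  assumes "\<forall>u. norm u \<le> 1 \<longrightarrow> poly q u \<noteq> 0"
  shows "avg (\<lambda>w. poly P (inverse w) * inverse (poly q (inverse w)) ^ n) = poly P 0 * inverse (poly q 0) ^ n"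
proof (rule avg_inverse[where T = "{u. poly q u \<noteq> 0}"])
  show "open {u. poly q u \<noteq> 0}"
    by (rule open_Collect_neq) (auto intro!: continuous_intros)
qed (use assms in \<open>auto intro!: holomorphic_intros simp: dist_norm\<close>)

text \<open>
  Since \<open>z\<^sup>-\<^sup>N\<close> vanishes to order \<open>N\<close> in \<open>1/w\<close>, its average against a function with a pole of order \<open>N\<close> at
  infinity is a nonzero multiple of the leading coefficient; hence the pole order can be lowered step by step.
\<close>

lemma Laurent_tendsto_0:
  assumes q: "\<forall>u. norm u \<le> 1 \<longrightarrow> poly q u \<noteq> 0"
    and "Laurent A" and avg: "\<And>k. avg (\<lambda>w. A w * inverse (zpol q w) ^ k) = 0"
  shows "(A \<longlongrightarrow> 0) at_infinity"
proof -
  have "(A \<longlongrightarrow> 0) at_infinity" if "\<And>w. w \<noteq> 0 \<Longrightarrow> A w = w ^ N * poly Q (inverse w)" for N Q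
    using that
  proof (induction N arbitrary: Q)
    case (0 Q)
    have "avg (\<lambda>w. A w * inverse (zpol q w) ^ 0) = avg (\<lambda>w. poly Q (inverse w) * inverse (poly q (inverse w)) ^ 0)"
      by (rule avg_cong) (simp add: 0[OF norm_1_nonzero])
    then have "coeff Q 0 = 0"
      using avg_inverse_rational[OF q, of Q 0] unfolding avg by (simp add: poly_0_coeff_0)
    with poly_inverse_tendsto[of Q] have "((\<lambda>w. poly Q (inverse w)) \<longlongrightarrow> 0) at_infinity"
      by simp
    then show ?case
      by (rule Lim_transform_eventually[OF _ eventually_mono[OF eventually_nonzero_at_infinity]])
         (simp add: 0)
  next
    case (Suc N Q)
    have "avg (\<lambda>w. A w * inverse (zpol q w) ^ Suc N) =
        avg (\<lambda>w. poly Q (inverse w) * inverse (poly q (inverse w)) ^ Suc N)"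
    proof (rule avg_cong)
      fix w :: complex assume "norm w = 1"
      then have "w \<noteq> 0" by (rule norm_1_nonzero)
      then show "A w * inverse (zpol q w) ^ Suc N = poly Q (inverse w) * inverse (poly q (inverse w)) ^ Suc N"
        by (simp add: Suc.prems zpol_def power_inverse field_simps)
    qed
    then have "poly Q 0 = 0"
      unfolding avg avg_inverse_rational[OF q] using q[rule_format, of 0] by simp
    then obtain Q' where "Q = pCons 0 Q'"
      by (metis pCons_cases poly_0_coeff_0 coeff_pCons_0)
    then show ?case
      using Suc.prems by (intro Suc.IH[of Q']) (simp add: field_simps)
  qed
  then show ?thesis
    using \<open>Laurent A\<close> unfolding Laurent_def by blast
qed

section \<open>Averages that identify the pairings at infinity\<close>

lemma zpol_has_field_derivative:
  assumes "w \<noteq> 0"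
  shows "(zpol q has_field_derivative inverse w * zpol (euler q) w) (at w)"
  unfolding zpol_def[abs_def] using assms
  by (auto intro!: derivative_eq_intros simp: euler_def field_simps power2_eq_square)

lemma continuous_on_zpol: "0 \<notin> S \<Longrightarrow> continuous_on S (zpol q)"
  by (rule holomorphic_on_imp_continuous_on[OF holomorphic_on_subset[OF holomorphic_zpol]]) auto

lemma continuous_on_tilde_zpol: "0 \<notin> S \<Longrightarrow> continuous_on S (tilde (zpol q))"
  by (rule holomorphic_on_imp_continuous_on[OF holomorphic_on_subset[OF holomorphic_tilde_zpol]]) auto

lemma tilde_zpol_has_field_derivative:
  assumes "w \<noteq> 0"
  shows "(tilde (zpol q) has_field_derivative - (inverse w * tilde (zpol (euler q)) w)) (at w)"
proof -
  have euler: "map_poly cnj (euler q) = map_poly cnj q - pCons 0 (pderiv (map_poly cnj q))"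
    by (rule poly_eqI) (simp add: euler_def coeff_map_poly coeff_pCons coeff_pderiv split: nat.split)
  have "((\<lambda>w. inverse w * poly (map_poly cnj q) w) has_field_derivative
      - (inverse w * (inverse w * poly (map_poly cnj (euler q)) w))) (at w)"
    unfolding euler using assms
    by (auto intro!: derivative_eq_intros simp del: poly_map_poly_cnj simp: field_simps power2_eq_square)
  then show ?thesis
    unfolding tilde_zpol[abs_def] .
qed

text \<open>The integrand is \<open>k z\<^sup>k\<^sup>-\<^sup>1\<^sup>-\<^sup>j \<theta>z\<close>.
  For \<open>j < k\<close> it is a multiple of \<open>\<theta>(z\<^sup>k\<^sup>-\<^sup>j)\<close>
  and averages to 0; for \<open>j \<ge> k\<close> it is holomorphic in \<open>1/w\<close> on the
  closed disc and vanishes to order \<open>j - k\<close> at infinity.\<close>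

lemma avg_moment_of_power:
  assumes q: "\<forall>u. norm u \<le> 1 \<longrightarrow> poly q u \<noteq> 0" and k: "k \<ge> 1"
  shows "avg (\<lambda>w. of_nat k * zpol q w ^ (k - 1) * zpol (euler q) w * inverse (zpol q w) ^ j) =
    (if j = k then of_nat k else 0)"
proof -
  have nz: "zpol q w \<noteq> 0" if "norm w = 1" for w
    using q[rule_format, of "inverse w"] that by (auto simp: zpol_def norm_inverse)
  show ?thesis
  proof (cases "j \<ge> k")
    case True
    define n where "n = j - k"
    have j: "j = Suc n + (k - 1)"
      using True k by (simp add: n_def)
    let ?P = "smult (of_nat k) (monom 1 n * euler q)"
    have "avg (\<lambda>w. of_nat k * zpol q w ^ (k - 1) * zpol (euler q) w * inverse (zpol q w) ^ j) =
      avg (\<lambda>w. poly ?P (inverse w) * inverse (poly q (inverse w)) ^ Suc n)"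
    proof (rule avg_cong)
      fix w :: complex assume w: "norm w = 1"
      have "zpol q w ^ (k - 1) * inverse (zpol q w) ^ j = inverse (zpol q w) ^ Suc n"
        unfolding j power_add using nz[OF w] by (simp add: power_inverse)
      moreover have "inverse (zpol q w) ^ Suc n = inverse w ^ Suc n * inverse (poly q (inverse w)) ^ Suc n"
        unfolding zpol_def by (simp only: inverse_mult_distrib power_mult_distrib)
      moreover have "zpol (euler q) w * inverse w ^ Suc n = inverse w ^ n * poly (euler q) (inverse w)"
        using norm_1_nonzero[OF w] by (simp add: zpol_def)
      ultimately show "of_nat k * zpol q w ^ (k - 1) * zpol (euler q) w * inverse (zpol q w) ^ j =
          poly ?P (inverse w) * inverse (poly q (inverse w)) ^ Suc n"
        by (simp add: poly_monom mult_ac del: power_Suc)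
    qed
    also have "\<dots> = of_nat k * 0 ^ n * (poly (euler q) 0 * inverse (poly q 0) ^ Suc n)"
      unfolding avg_inverse_rational[OF q] by (simp add: poly_monom)
    also have "\<dots> = (if j = k then of_nat k else 0)"
      using q[rule_format, of 0] True by (auto simp: n_def euler_def)
    finally show ?thesis .
  next
    case False
    define m where "m = k - j"
    have m: "m \<ge> 1" and k_eq: "k - 1 = (m - 1) + j"
      using False by (auto simp: m_def)
    have "avg (\<lambda>w. of_nat k * zpol q w ^ (k - 1) * zpol (euler q) w * inverse (zpol q w) ^ j) =
        avg (\<lambda>w. of_nat k / of_nat m * (w * (of_nat m * zpol q w ^ (m - 1) * (inverse w * zpol (euler q) w))))"
    proof (rule avg_cong)
      fix w :: complex assume w: "norm w = 1"
      have "zpol q w ^ (k - 1) * inverse (zpol q w) ^ j = zpol q w ^ (m - 1)"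
        unfolding k_eq power_add using nz[OF w] by (simp add: power_inverse)
      moreover have "of_nat k * zpol q w ^ (k - 1) * zpol (euler q) w * inverse (zpol q w) ^ j =
          of_nat k * (zpol q w ^ (k - 1) * inverse (zpol q w) ^ j) * zpol (euler q) w"
        by (simp only: mult_ac)
      ultimately have "of_nat k * zpol q w ^ (k - 1) * zpol (euler q) w * inverse (zpol q w) ^ j =
          of_nat k * zpol q w ^ (m - 1) * zpol (euler q) w"
        by (simp only:)
      then show "of_nat k * zpol q w ^ (k - 1) * zpol (euler q) w * inverse (zpol q w) ^ j =
          of_nat k / of_nat m * (w * (of_nat m * zpol q w ^ (m - 1) * (inverse w * zpol (euler q) w)))"
        using norm_1_nonzero[OF w] m by (simp add: field_simps)
    qed
    also have "\<dots> = of_nat k / of_nat m * 0"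
      unfolding avg_cmult
    proof (intro arg_cong2[where f = "(*)"] refl avg_deriv_eq_0)
      fix w :: complex assume "norm w = 1"
      then show "((\<lambda>w. zpol q w ^ m) has_field_derivative
          of_nat m * zpol q w ^ (m - 1) * (inverse w * zpol (euler q) w)) (at w)"
        by (auto intro!: derivative_eq_intros zpol_has_field_derivative norm_1_nonzero)
    qed
    finally show ?thesis using False by simp
  qed
qed

lemma avg_moment_of_one:
  assumes q: "\<forall>u. norm u \<le> 1 \<longrightarrow> poly q u \<noteq> 0"
  shows "avg (\<lambda>w. inverse (zpol q w) ^ j) = (if j = 0 then 1 else 0)"
proof -
  have "avg (\<lambda>w. inverse (zpol q w) ^ j) = avg (\<lambda>w. poly (monom 1 j) (inverse w) * inverse (poly q (inverse w)) ^ j)"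
    by (rule avg_cong) (simp add: zpol_def poly_monom power_mult_distrib)
  also have "\<dots> = (if j = 0 then 1 else 0)"
    unfolding avg_inverse_rational[OF q] by (simp add: poly_monom)
  finally show ?thesis .
qed

lemma continuous_on_inverse_zpol:
  assumes q: "\<forall>u. norm u \<le> 1 \<longrightarrow> poly q u \<noteq> 0"
  shows "continuous_on (sphere 0 1) (\<lambda>w. inverse (zpol q w))"
proof (intro continuous_intros continuous_on_zpol ballI)
  show "zpol q w \<noteq> 0" if "w \<in> sphere 0 1" for w
    using q[rule_format, of "inverse w"] that by (auto simp: zpol_def norm_inverse)
qed simp

lemma continuous_on_pairing: "0 \<notin> S \<Longrightarrow> continuous_on S (pairing q a b)"
  by (rule holomorphic_on_imp_continuous_on[OF holomorphic_on_subset[OF holomorphic_pairing]]) auto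

text \<open>Subtracting a Laurent polynomial with the same averages leaves one that vanishes at
  infinity; here the comparison function is the constant 1, next it is
  \<open>\<theta>(z\<^sup>k)\<close>, then 0.\<close>

lemma pairing_tendsto_1:
  assumes q: "\<forall>u. norm u \<le> 1 \<longrightarrow> poly q u \<noteq> 0"
    and avg: "\<And>j. avg (\<lambda>w. pairing q a b w * inverse (zpol q w) ^ j) = (if j = 0 then 1 else 0)"
  shows "(pairing q a b \<longlongrightarrow> 1) at_infinity"
proof -
  have "((\<lambda>w. pairing q a b w - 1) \<longlongrightarrow> 0) at_infinity"
  proof (rule Laurent_tendsto_0[OF q])
    show "Laurent (\<lambda>w. pairing q a b w - 1)"
      by (intro Laurent_intros Laurent_pairing)
    show "avg (\<lambda>w. (pairing q a b w - 1) * inverse (zpol q w) ^ j) = 0" for j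
      unfolding left_diff_distrib mult_1
      by (subst avg_diff)
         (auto intro!: continuous_intros continuous_on_pairing continuous_on_inverse_zpol q
           simp: avg avg_moment_of_one[OF q] simp del: power_inverse)
  qed
  then show ?thesis by (simp add: LIM_zero_iff)
qed

lemma pairing_tendsto_power:
  assumes q: "\<forall>u. norm u \<le> 1 \<longrightarrow> poly q u \<noteq> 0" and k: "k \<ge> 1"
    and avg: "\<And>j. avg (\<lambda>w. pairing q a b w * inverse (zpol q w) ^ j) = (if j = k then of_nat k else 0)"
  shows "((\<lambda>w. pairing q a b w - of_nat k * zpol q w ^ (k - 1) * zpol (euler q) w) \<longlongrightarrow> 0) at_infinity"
proof (rule Laurent_tendsto_0[OF q])
  show "Laurent (\<lambda>w. pairing q a b w - of_nat k * zpol q w ^ (k - 1) * zpol (euler q) w)"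
    by (intro Laurent_intros Laurent_pairing)
  show "avg (\<lambda>w. (pairing q a b w - of_nat k * zpol q w ^ (k - 1) * zpol (euler q) w) * inverse (zpol q w) ^ j) = 0" for j
    unfolding left_diff_distrib
    by (subst avg_diff)
       (auto intro!: continuous_intros continuous_on_pairing continuous_on_inverse_zpol continuous_on_zpol q
         simp: avg avg_moment_of_power[OF q k] simp del: power_inverse One_nat_def)
qed

lemma pairing_tendsto_0:
  assumes q: "\<forall>u. norm u \<le> 1 \<longrightarrow> poly q u \<noteq> 0"
    and avg: "\<And>j. avg (\<lambda>w. pairing q a b w * inverse (zpol q w) ^ j) = 0"
  shows "(pairing q a b \<longlongrightarrow> 0) at_infinity"
  by (rule Laurent_tendsto_0[OF q Laurent_pairing avg])

text \<open>For the polynomial of a curve this is \<open>t\<^sub>0\<close> if \<open>j = 0\<close> and \<open>j t\<^sub>j\<close> otherwise.\<close>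

definition moment :: "complex poly \<Rightarrow> nat \<Rightarrow> complex" where
  "moment q j = avg (\<lambda>w. tilde (zpol q) w * inverse (zpol q w) ^ j * zpol (euler q) w)"

section \<open>Variation of the moments along a path of polynomials\<close>

lemma inverse_power_has_field_derivative:
  assumes "(z :: complex) \<noteq> 0"
  shows "((\<lambda>z. inverse z ^ j) has_field_derivative - (of_nat j * inverse z ^ Suc j)) (at z within S)"
proof -
  have "((\<lambda>z. inverse z ^ j) has_field_derivative
      of_nat j * (- (inverse z ^ Suc (Suc 0)) * inverse z ^ (j - Suc 0))) (at z within S)"
    by (rule DERIV_power[OF DERIV_inverse[OF assms]])
  then show ?thesis
    by (rule DERIV_cong) (cases j; simp add: mult_ac del: power_inverse)
qed

text \<open>The left integrand is the formal variation of
  \<open>z\<^sup>~ z\<^sup>-\<^sup>j \<theta>z\<close>. It exceeds the right one by the total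
  derivative \<open>\<theta>(z\<^sup>~ z\<^sup>-\<^sup>j \<partial>z)\<close>; \<open>f'\<close> is
  the derivative of the function in parentheses.\<close>

lemma moment_variation_by_parts:
  assumes nz: "\<And>w. norm w = 1 \<Longrightarrow> zpol q w \<noteq> 0"
  shows "avg (\<lambda>w. (tilde (zpol p) w * inverse (zpol q w) ^ j +
        tilde (zpol q) w * (zpol p w * - (of_nat j * inverse (zpol q w) ^ Suc j))) * zpol (euler q) w +
        tilde (zpol q) w * inverse (zpol q w) ^ j * zpol (euler p) w) =
    avg (\<lambda>w. pairing q p p w * inverse (zpol q w) ^ j)" (is "avg ?L = avg ?R")
proof -
  define f' where "f' = (\<lambda>w. tilde (zpol q) w * (inverse (zpol q w) ^ j * (inverse w * zpol (euler p) w) +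
      - (of_nat j * inverse (zpol q w) ^ Suc j) * (inverse w * zpol (euler q) w) * zpol p w) +
      - (inverse w * tilde (zpol (euler q)) w) * (inverse (zpol q w) ^ j * zpol p w))"
  have cinv: "continuous_on (sphere 0 1) (\<lambda>w. inverse (zpol q w))"
    by (intro continuous_intros continuous_on_zpol) (auto simp: nz)
  have "avg (\<lambda>w. w * f' w) = 0"
  proof (rule avg_deriv_eq_0)
    fix w :: complex assume w: "norm w = 1"
    have "((\<lambda>w. inverse (zpol q w) ^ j) has_field_derivative
        - (of_nat j * inverse (zpol q w) ^ Suc j) * (inverse w * zpol (euler q) w)) (at w)"
      by (rule DERIV_chain2[OF inverse_power_has_field_derivative[OF nz[OF w]] zpol_has_field_derivative[OF norm_1_nonzero[OF w]]])
    from DERIV_mult[OF tilde_zpol_has_field_derivative[OF norm_1_nonzero[OF w], of q]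
        DERIV_mult[OF this zpol_has_field_derivative[OF norm_1_nonzero[OF w], of p]]]
    show "((\<lambda>w. tilde (zpol q) w * (inverse (zpol q w) ^ j * zpol p w)) has_field_derivative f' w) (at w)"
      by (rule DERIV_cong) (simp add: f'_def algebra_simps)
  qed
  then have "avg ?R = avg ?R + avg (\<lambda>w. w * f' w)"
    by simp
  also have "\<dots> = avg (\<lambda>w. ?R w + w * f' w)"
    unfolding f'_def
    by (rule avg_add[symmetric])
       (auto intro!: continuous_intros continuous_on_pairing continuous_on_zpol continuous_on_tilde_zpol cinv
         simp del: power_inverse power_Suc)
  also have "\<dots> = avg ?L"
  proof (rule avg_cong)
    fix w :: complex assume "norm w = 1"
    then have cancel: "w * (inverse w * y) = y" for y
      by (simp add: norm_1_nonzero mult.assoc[symmetric])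
    define h where "h = tilde (zpol q) w * (inverse (zpol q w) ^ j * zpol (euler p) w +
      - (of_nat j * inverse (zpol q w) ^ Suc j) * zpol (euler q) w * zpol p w) +
      - tilde (zpol (euler q)) w * (inverse (zpol q w) ^ j * zpol p w)"
    have "f' w = inverse w * h"
      unfolding f'_def h_def by (simp only: algebra_simps mult_minus_left mult_minus_right)
    then have "w * f' w = h"
      by (simp only: cancel)
    then show "?R w + w * f' w = ?L w"
      by (simp only: pairing_def h_def algebra_simps mult_minus_left mult_minus_right)
        (simp del: power_inverse power_Suc)
  qed
  finally show ?thesis by simp
qed

lemma poly_eq_sum_le:
  fixes p :: "'a::comm_semiring_1 poly"
  assumes "degree p \<le> D"
  shows "poly p u = (\<Sum>i\<le>D. coeff p i * u ^ i)"
proof -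
  have "(\<Sum>i\<le>degree p. coeff p i * u ^ i) = (\<Sum>i\<le>D. coeff p i * u ^ i)"
    using assms by (intro sum.mono_neutral_left) (auto simp: coeff_eq_0)
  then show ?thesis by (simp add: poly_altdef)
qed

text \<open>A continuously differentiable path, described coefficientwise. The common degree bound
  \<open>D\<close> makes evaluation a sum of fixed length, which yields joint continuity in the path
  parameter and the point.\<close>

definition poly_path :: "nat \<Rightarrow> real set \<Rightarrow> (real \<Rightarrow> complex poly) \<Rightarrow> (real \<Rightarrow> complex poly) \<Rightarrow> bool" where
  "poly_path D U q q' \<longleftrightarrow> (\<forall>s\<in>U. degree (q s) \<le> D \<and> degree (q' s) \<le> D \<and>
     (\<forall>i. ((\<lambda>s. coeff (q s) i) has_vector_derivative coeff (q' s) i) (at s within U))) \<and>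
     (\<forall>i. continuous_on U (\<lambda>s. coeff (q' s) i))"

lemma degree_euler: "degree (euler q) \<le> degree q"
proof -
  have "degree (pCons 0 (pderiv q)) \<le> degree q"
    by (cases "degree q = 0") (auto simp: degree_pCons_eq_if degree_pderiv pderiv_eq_0_iff)
  then show ?thesis
    unfolding euler_def by (intro degree_diff_le) auto
qed

lemma coeff_euler: "coeff (euler q) i = (1 - of_nat i) * coeff q i"
  by (cases i) (auto simp: euler_def coeff_pderiv algebra_simps)

lemma poly_path_euler:
  assumes "poly_path D U q q'"
  shows "poly_path D U (\<lambda>s. euler (q s)) (\<lambda>s. euler (q' s))"
  using assms unfolding poly_path_def coeff_euler
  by (auto intro!: continuous_intros has_vector_derivative_mult_right order_trans[OF degree_euler])

lemma poly_path_poly: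
  assumes "poly_path D U q q'" "s \<in> U"
  shows "((\<lambda>s. poly (q s) u) has_vector_derivative poly (q' s) u) (at s within U)"
proof (rule has_vector_derivative_transform[OF assms(2)])
  show "poly (q s) u = (\<Sum>i\<le>D. coeff (q s) i * u ^ i)" if "s \<in> U" for s
    using assms that by (intro poly_eq_sum_le) (auto simp: poly_path_def)
  have "poly (q' s) u = (\<Sum>i\<le>D. coeff (q' s) i * u ^ i)"
    using assms by (intro poly_eq_sum_le) (auto simp: poly_path_def)
  then show "((\<lambda>s. \<Sum>i\<le>D. coeff (q s) i * u ^ i) has_vector_derivative poly (q' s) u) (at s within U)"
    using assms by (auto simp: poly_path_def intro!: has_vector_derivative_sum has_vector_derivative_mult_left)
qed

lemma poly_path_zpol:
  assumes "poly_path D U q q'" "s \<in> U"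
  shows "((\<lambda>s. zpol (q s) w) has_vector_derivative zpol (q' s) w) (at s within U)"
  unfolding zpol_def by (intro has_vector_derivative_mult_right poly_path_poly[OF assms])

lemma poly_path_tilde:
  assumes "poly_path D U q q'" "s \<in> U"
  shows "((\<lambda>s. tilde (zpol (q s)) w) has_vector_derivative tilde (zpol (q' s)) w) (at s within U)"
  unfolding tilde_def
  by (rule bounded_linear.has_vector_derivative[OF bounded_linear_cnj poly_path_zpol[OF assms]])

lemma continuous_on_zpol_path:
  assumes "\<And>i. continuous_on U (\<lambda>s. coeff (q s) i)" "\<And>s. s \<in> U \<Longrightarrow> degree (q s) \<le> D"
  shows "continuous_on (U \<times> T) (\<lambda>(s, x). zpol (q s) (cis (2 * pi * x)))"
proof -
  have "continuous_on (U \<times> T) (\<lambda>p. cis (2 * pi * snd p) * (\<Sum>i\<le>D. coeff (q (fst p)) i * inverse (cis (2 * pi * snd p)) ^ i))"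
    by (intro continuous_intros continuous_on_compose2[OF assms(1)]) auto
  then show ?thesis
    unfolding split_beta
  proof (rule continuous_on_eq)
    fix p :: "'a \<times> real" assume "p \<in> U \<times> T"
    then show "cis (2 * pi * snd p) * (\<Sum>i\<le>D. coeff (q (fst p)) i * inverse (cis (2 * pi * snd p)) ^ i) =
        zpol (q (fst p)) (cis (2 * pi * snd p))"
      unfolding zpol_def using poly_eq_sum_le[OF assms(2), of "fst p"] by auto
  qed
qed

lemma tilde_circle: "norm w = 1 \<Longrightarrow> tilde f w = cnj (f w)"
proof -
  assume "norm w = 1"
  then have "inverse (cnj w) = w"
    by (intro inverse_unique) (simp add: mult.commute[of "cnj w"] complex_norm_square[symmetric])
  then show ?thesis
    by (simp add: tilde_def)
qed

lemma continuous_on_tilde_path: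
  assumes "continuous_on (U \<times> T) (\<lambda>(s, x). f s (cis (2 * pi * x)))"
  shows "continuous_on (U \<times> T) (\<lambda>(s, x). tilde (f s) (cis (2 * pi * x)))"
  using continuous_on_cnj[OF assms] by (simp add: tilde_circle split_beta)

text \<open>Differentiation under the average, justified by joint continuity of the differentiated
  integrand, followed by integration by parts.\<close>

lemma moment_has_vector_derivative:
  assumes path: "poly_path D U q q'" and U: "convex U" "s \<in> U"
    and nz: "\<And>s w. s \<in> U \<Longrightarrow> norm w = 1 \<Longrightarrow> zpol (q s) w \<noteq> 0"
  shows "((\<lambda>s. moment (q s) j) has_vector_derivative
      avg (\<lambda>w. pairing (q s) (q' s) (q' s) w * inverse (zpol (q s) w) ^ j)) (at s within U)"
proof -
  define f where "f = (\<lambda>s w. tilde (zpol (q s)) w * inverse (zpol (q s) w) ^ j * zpol (euler (q s)) w)"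
  define f' where "f' = (\<lambda>s w. (tilde (zpol (q' s)) w * inverse (zpol (q s) w) ^ j +
        tilde (zpol (q s)) w * (zpol (q' s) w * - (of_nat j * inverse (zpol (q s) w) ^ Suc j))) * zpol (euler (q s)) w +
        tilde (zpol (q s)) w * inverse (zpol (q s) w) ^ j * zpol (euler (q' s)) w)"
  have cq: "continuous_on U (\<lambda>s. coeff (q s) i)" for i
    using path by (auto simp: poly_path_def continuous_on_eq_continuous_within intro: has_vector_derivative_continuous)
  have cq': "continuous_on U (\<lambda>s. coeff (q' s) i)" for i
    using path by (auto simp: poly_path_def)
  have deg: "degree (q s) \<le> D" "degree (q' s) \<le> D" "degree (euler (q s)) \<le> D" "degree (euler (q' s)) \<le> D"
    if "s \<in> U" for s
    using path that order_trans[OF degree_euler] by (auto simp: poly_path_def)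
  note cz = continuous_on_zpol_path[OF cq deg(1)] continuous_on_zpol_path[OF cq' deg(2)]
    continuous_on_zpol_path[of U "\<lambda>s. euler (q s)" D] continuous_on_zpol_path[of U "\<lambda>s. euler (q' s)" D]
  have cE: "continuous_on U (\<lambda>s. coeff (euler (q s)) i)" "continuous_on U (\<lambda>s. coeff (euler (q' s)) i)" for i
    unfolding coeff_euler by (intro continuous_intros cq cq')+
  have "continuous_on (U \<times> cbox 0 1) (\<lambda>p. f' (fst p) (cis (2 * pi * snd p)))"
    unfolding f'_def
    using cz(1,2) cz(3)[OF cE(1) deg(3)] cz(4)[OF cE(2) deg(4)]
      continuous_on_tilde_path[OF cz(1)] continuous_on_tilde_path[OF cz(2)] 
    unfolding split_beta
    by (intro continuous_intros) (auto simp: nz)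
  then have cont': "continuous_on (U \<times> cbox 0 1) (\<lambda>(s, x). f' s (cis (2 * pi * x)))"
    by (simp add: split_beta)
  have cont: "continuous_on (sphere 0 1) (f s)" if "s \<in> U" for s
    unfolding f_def
    by (intro continuous_intros continuous_on_zpol continuous_on_tilde_zpol) (auto simp: nz that)
  have deriv: "((\<lambda>s. f s w) has_vector_derivative f' s w) (at s within U)" if "s \<in> U" "norm w = 1" for s w
  proof -
    have "((\<lambda>s. inverse (zpol (q s) w) ^ j) has_vector_derivative
        zpol (q' s) w * - (of_nat j * inverse (zpol (q s) w) ^ Suc j)) (at s within U)"
      using field_vector_diff_chain_within[OF poly_path_zpol[OF path that(1), of w]
          inverse_power_has_field_derivative[OF nz[OF that]]] by (simp add: o_def)
    from has_vector_derivative_mult[OF has_vector_derivative_mult[OF poly_path_tilde[OF path that(1), of w] this]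
        poly_path_zpol[OF poly_path_euler[OF path] that(1), of w]]
    show ?thesis
      by (simp only: f_def f'_def add_ac)
  qed
  have "((\<lambda>s. integral (cbox 0 1) (\<lambda>x. f s (cis (2 * pi * x)))) has_vector_derivative
      integral (cbox 0 1) (\<lambda>x. f' s (cis (2 * pi * x)))) (at s within U)"
    by (rule leibniz_rule_vector_derivative[OF _ _ cont' U(2,1)])
       (auto intro!: deriv integrable_on_cis_circle cont)
  then have "((\<lambda>s. moment (q s) j) has_vector_derivative avg (f' s)) (at s within U)"
    by (simp add: moment_def avg_def f_def)
  also have "avg (f' s) = avg (\<lambda>w. pairing (q s) (q' s) (q' s) w * inverse (zpol (q s) w) ^ j)"
    unfolding f'_def using nz[OF U(2)] by (rule moment_variation_by_parts)
  finally show ?thesis .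
qed

text \<open>By the argument principle the average of \<open>u q'(u) / q(u)\<close> counts the zeros
  in the open disc with multiplicity.\<close>

lemma poly_nonzero_in_disc:
  assumes circle: "\<And>u. norm u = 1 \<Longrightarrow> poly q u \<noteq> 0"
    and avg: "avg (\<lambda>u. u * (poly (pderiv q) u / poly q u)) = 0"
    and u: "norm u \<le> 1"
  shows "poly q u \<noteq> 0"
proof
  assume zero: "poly q u = 0"
  \<comment> \<open>Zeros and poles in the shape used by \<open>argument_principle\<close>, with
    empty pole set. Zeros outside the disc belong to \<open>Z\<close> but have winding number
    0.\<close>
  define Z where "Z = {w \<in> UNIV. poly q w = 0 \<or> w \<in> {}}"
  have "q \<noteq> 0" using circle[of 1] by auto
  then have fin: "finite Z"
    unfolding Z_def using poly_roots_finite[of q] by simp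
  have "contour_integral (circlepath 0 1) (\<lambda>x. deriv (poly q) x * 1 / poly q x) = 2 * pi * \<i> *
      (\<Sum>p\<in>Z. winding_number (circlepath 0 1) p * 1 * zorder (poly q) p)"
    unfolding Z_def
    by (rule argument_principle) (use circle fin in \<open>auto simp: Z_def intro!: holomorphic_intros\<close>)
  also have "contour_integral (circlepath 0 1) (\<lambda>x. deriv (poly q) x * 1 / poly q x) = 0"
    unfolding contour_integral_circlepath_avg DERIV_imp_deriv[OF poly_DERIV] using avg by simp
  finally have sum0: "(\<Sum>p\<in>Z. winding_number (circlepath 0 1) p * 1 * zorder (poly q) p) = 0"
    by simp
  have pos: "zorder (poly q) p > 0" if "p \<in> Z" for p
  proof -
    have "\<exists>\<^sub>F z in at p. poly q z \<noteq> 0"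
    proof (rule eventually_frequently)
      have "open (- (Z - {p}))"
        using fin by (intro open_Compl finite_imp_closed) auto
      then have "\<forall>\<^sub>F z in nhds p. z \<in> - (Z - {p})"
        by (rule eventually_nhds_in_open) auto
      then show "\<forall>\<^sub>F z in at p. poly q z \<noteq> 0"
        unfolding eventually_at_filter by eventually_elim (auto simp: Z_def)
    qed simp
    moreover have "(\<lambda>z. poly q z) holomorphic_on UNIV"
      by (intro holomorphic_intros)
    ultimately show ?thesis
      using that zorder_pos_iff[of "poly q" UNIV p] by (auto simp: Z_def)
  qed
  have wn: "winding_number (circlepath 0 1) p = (if norm p < 1 then 1 else 0)" if "p \<in> Z" for p
  proof (cases "norm p < 1")
    case True
    then show ?thesis by (simp add: winding_number_circlepath)
  next
    case False
    then have "norm p > 1"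
      using circle[of p] that by (force simp: Z_def)
    then show ?thesis
      by (simp add: winding_number_zero_outside[of _ "cball 0 1"])
  qed
  have "(\<Sum>p\<in>Z. if norm p < 1 then zorder (poly q) p else 0) = 0"
  proof -
    have "complex_of_int (\<Sum>p\<in>Z. if norm p < 1 then zorder (poly q) p else 0) =
        (\<Sum>p\<in>Z. winding_number (circlepath 0 1) p * 1 * zorder (poly q) p)"
      unfolding of_int_sum by (rule sum.cong) (auto simp: wn)
    then show ?thesis
      unfolding sum0 by (simp only: of_int_eq_0_iff)
  qed
  then have "(if norm u < 1 then zorder (poly q) u else 0) = 0"
    using fin zero pos by (subst (asm) sum_nonneg_eq_0_iff) (auto simp: Z_def less_imp_le)
  moreover have "norm u < 1" "u \<in> Z"
    using u zero circle[of u] by (force simp: Z_def)+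
  ultimately show False
    using pos[of u] by simp
qed

section \<open>Moments of polynomial curves\<close>

definition curve_poly :: "curve \<Rightarrow> complex poly" where
  "curve_poly \<gamma> = pCons (of_real (fst \<gamma>)) (snd \<gamma>)"

lemma param_eq_zpol: "w \<noteq> 0 \<Longrightarrow> param \<gamma> w = zpol (curve_poly \<gamma>) w"
  by (simp add: param_def zpol_def curve_poly_def algebra_simps)

lemma loop_eq: "loop \<gamma> x = zpol (curve_poly \<gamma>) (cis (2 * pi * x))"
proof -
  have "circlepath 0 1 x = cis (2 * pi * x)"
    by (simp add: circlepath cis_conv_exp mult_ac)
  then show ?thesis
    by (simp add: loop_def param_eq_zpol)
qed

lemma loop_has_vector_derivative:
  "(loop \<gamma> has_vector_derivative 2 * pi * \<i> * zpol (euler (curve_poly \<gamma>)) (cis (2 * pi * x))) (at x within S)"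
proof -
  have "((zpol (curve_poly \<gamma>) \<circ> (\<lambda>x. cis (2 * pi * x))) has_vector_derivative
      (2 * pi * \<i> * cis (2 * pi * x)) * (inverse (cis (2 * pi * x)) * zpol (euler (curve_poly \<gamma>)) (cis (2 * pi * x))))
      (at x within S)"
    by (rule field_vector_diff_chain_within[OF has_vector_derivative_cis_circle
          has_field_derivative_at_within[OF zpol_has_field_derivative]]) simp
  moreover have "zpol (curve_poly \<gamma>) \<circ> (\<lambda>x. cis (2 * pi * x)) = loop \<gamma>"
    by (auto simp: loop_eq)
  moreover have "(2 * pi * \<i> * w) * (inverse w * y) = 2 * pi * \<i> * y" if "w \<noteq> 0" for w y :: complex
    using that by simp
  ultimately show ?thesis
    by (metis cis_neq_zero)
qed

lemma contour_integral_loop: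
  "contour_integral (loop \<gamma>) f =
    2 * pi * \<i> * avg (\<lambda>w. f (zpol (curve_poly \<gamma>) w) * zpol (euler (curve_poly \<gamma>)) w)"
proof -
  have "contour_integral (loop \<gamma>) f = integral {0..1} (\<lambda>x. 2 * pi * \<i> *
      (f (zpol (curve_poly \<gamma>) (cis (2 * pi * x))) * zpol (euler (curve_poly \<gamma>)) (cis (2 * pi * x))))"
    unfolding contour_integral_integral vector_derivative_at[OF loop_has_vector_derivative] loop_eq
    by (simp add: mult_ac)
  then show ?thesis
    unfolding avg_def by (simp only: integral_mult_right)
qed

lemma ext_moment_eq:
  assumes "k \<ge> 1"
  shows "of_nat k * ext_moment \<gamma> k = moment (curve_poly \<gamma>) k"
proof -
  have "avg (\<lambda>w. cnj (zpol (curve_poly \<gamma>) w) * inverse (zpol (curve_poly \<gamma>) w) ^ k * zpol (euler (curve_poly \<gamma>)) w) =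
      moment (curve_poly \<gamma>) k"
    unfolding moment_def by (rule avg_cong) (simp add: tilde_circle)
  then show ?thesis
    unfolding ext_moment_def contour_integral_loop using assms by (simp add: field_simps)
qed

text \<open>On the circle \<open>Im z = (z - z\<^sup>~) / (2\<i>)\<close>. The part with
  \<open>z \<theta>z = \<theta>(z\<^sup>2 / 2)\<close> averages to 0 and the other is the moment of
  index 0.\<close>

lemma enclosed_area_eq:
  assumes "polynomial_curve d \<gamma>" "positively_oriented \<gamma>"
  shows "of_real (enclosed_area \<gamma>) = of_real pi * moment (curve_poly \<gamma>) 0"
proof -
  let ?z = "zpol (curve_poly \<gamma>)" and ?E = "zpol (euler (curve_poly \<gamma>))"
  have cz: "continuous_on (sphere 0 1) ?z" "continuous_on (sphere 0 1) ?E"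
    "continuous_on (sphere 0 1) (tilde ?z)"
    by (intro continuous_on_zpol continuous_on_tilde_zpol; simp)+
  have "of_real (enclosed_area \<gamma>) = - integral {0..1}
      (\<lambda>x. Im (loop \<gamma> x) * (2 * pi * \<i> * ?E (cis (2 * pi * x))))"
    unfolding enclosed_area_def
  proof (rule measure_inside_closed_curve)
    show "(loop \<gamma> has_vector_derivative 2 * pi * \<i> * ?E (cis (2 * pi * x))) (at x)" for x
      by (rule loop_has_vector_derivative)
    show "continuous_on UNIV (\<lambda>x. 2 * pi * \<i> * ?E (cis (2 * pi * x)))"
      by (intro continuous_intros continuous_on_cis_circle cz)
    show "loop \<gamma> 1 = loop \<gamma> 0"
      by (simp add: loop_eq)
    show "winding_number (loop \<gamma>) u = 1" if "u \<in> inside (path_image (loop \<gamma>))" for u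
      using assms(2) that by (simp add: positively_oriented_def)
  qed
  also have "\<dots> = - avg (\<lambda>w. Im (?z w) * (2 * pi * \<i> * ?E w))"
    unfolding avg_def loop_eq ..
  also have "avg (\<lambda>w. Im (?z w) * (2 * pi * \<i> * ?E w)) = avg (\<lambda>w. of_real pi * (?z w * ?E w - tilde ?z w * ?E w))"
  proof (rule avg_cong)
    fix w :: complex assume w: "norm w = 1"
    have "?z w - tilde ?z w = 2 * \<i> * Im (?z w)"
      unfolding tilde_circle[OF w] by (rule complex_diff_cnj[THEN trans]) (simp add: mult_ac)
    then have "of_real pi * ((?z w - tilde ?z w) * ?E w) = of_real pi * (2 * \<i> * Im (?z w) * ?E w)"
      by (simp only:)
    then show "Im (?z w) * (2 * pi * \<i> * ?E w) = of_real pi * (?z w * ?E w - tilde ?z w * ?E w)"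
      unfolding left_diff_distrib[symmetric] by (simp only:) simp
  qed
  also have "\<dots> = of_real pi * (avg (\<lambda>w. ?z w * ?E w) - moment (curve_poly \<gamma>) 0)"
    unfolding avg_cmult by (subst avg_diff) (auto simp: moment_def intro!: continuous_intros cz)
  also have "avg (\<lambda>w. ?z w * ?E w) = avg (\<lambda>w. w * (?z w * (inverse w * ?E w)))"
  proof (rule avg_cong)
    fix w :: complex assume "norm w = 1"
    then have "w \<noteq> 0" by (rule norm_1_nonzero)
    then show "?z w * ?E w = w * (?z w * (inverse w * ?E w))"
      by simp
  qed
  also have "\<dots> = 0"
  proof (rule avg_deriv_eq_0)
    show "((\<lambda>w. ?z w ^ 2 / 2) has_field_derivative ?z w * (inverse w * ?E w)) (at w)" if "norm w = 1" for w
    proof -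
      have "(?z has_field_derivative inverse w * ?E w) (at w)"
        using that by (intro zpol_has_field_derivative norm_1_nonzero)
      from DERIV_cdivide[OF DERIV_power[OF this, of 2], of 2] show ?thesis
        by (simp add: mult_ac)
    qed
  qed
  finally show ?thesis by simp
qed

text \<open>The origin has winding number 1, so \<open>\<theta>z / z\<close> has average 1. In
  \<open>u = 1/w\<close> this quotient is \<open>1 - u q'(u) / q(u)\<close>, so the zero count of
  \<open>q\<close> in the disc is 0.\<close>

lemma curve_poly_nonzero:
  assumes "positively_oriented \<gamma>" "encircles_origin \<gamma>"
  shows "\<forall>u. norm u \<le> 1 \<longrightarrow> poly (curve_poly \<gamma>) u \<noteq> 0"
proof -
  let ?q = "curve_poly \<gamma>"
  have "0 \<notin> path_image (loop \<gamma>)"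
    using assms(2) inside_no_overlap unfolding encircles_origin_def by blast
  have circle: "poly ?q u \<noteq> 0" if u: "norm u = 1" for u
  proof
    assume "poly ?q u = 0"
    have "norm (inverse u) = 1"
      using u by (simp add: norm_inverse)
    define x where "x = Arg2pi (inverse u) / (2 * pi)"
    have x: "0 \<le> x" "x < 1"
      using Arg2pi_ge_0[of "inverse u"] Arg2pi_lt_2pi[of "inverse u"] by (simp_all add: x_def)
    have cis: "inverse u = cis (2 * pi * x)"
      using \<open>norm (inverse u) = 1\<close> unfolding complex_norm_eq_1_exp by (simp add: x_def cis_conv_exp)
    have "loop \<gamma> x = 0"
      unfolding loop_eq cis[symmetric] zpol_def using \<open>poly ?q u = 0\<close> by simp
    then show False
      using \<open>0 \<notin> _\<close> x unfolding path_image_def by (metis atLeastAtMost_iff image_eqI less_imp_le)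
  qed
  have vp: "valid_path (loop \<gamma>)"
    unfolding valid_path_def
  proof (rule C1_differentiable_imp_piecewise)
    have "continuous_on {0..1} (\<lambda>x. 2 * pi * \<i> * zpol (euler (curve_poly \<gamma>)) (cis (2 * pi * x)))"
      by (intro continuous_intros continuous_on_cis_circle continuous_on_zpol) simp
    then show "loop \<gamma> C1_differentiable_on {0..1}"
      unfolding C1_differentiable_on_def
    proof (intro exI conjI ballI)
      show "(loop \<gamma> has_vector_derivative 2 * pi * \<i> * zpol (euler (curve_poly \<gamma>)) (cis (2 * pi * x))) (at x)" for x
        by (rule loop_has_vector_derivative)
    qed
  qed
  define F where "F = (\<lambda>u. u * (poly (pderiv ?q) u / poly ?q u))"
  have "avg (\<lambda>w. 1 / zpol ?q w * zpol (euler ?q) w) = 1"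
    using winding_number_valid_path[OF vp \<open>0 \<notin> _\<close>] assms
    by (simp add: contour_integral_loop positively_oriented_def encircles_origin_def)
  moreover have "avg (\<lambda>w. 1 / zpol ?q w * zpol (euler ?q) w) =
      avg (\<lambda>w. 1 - F (inverse w))"
  proof (rule avg_cong)
    fix w :: complex assume w: "norm w = 1"
    have "norm (inverse w) = 1"
      using w by (simp add: norm_inverse)
    then have "poly ?q (inverse w) \<noteq> 0"
      by (rule circle)
    moreover have "1 / zpol ?q w * zpol (euler ?q) w =
        (poly ?q (inverse w) - inverse w * poly (pderiv ?q) (inverse w)) / poly ?q (inverse w)"
      using norm_1_nonzero[OF w] by (simp add: zpol_def euler_def)
    ultimately show "1 / zpol ?q w * zpol (euler ?q) w =
        1 - F (inverse w)"
      by (simp add: F_def diff_divide_distrib)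
  qed
  moreover have cF: "continuous_on (sphere 0 1) F"
    unfolding F_def by (intro continuous_intros) (auto simp: circle)
  moreover have "continuous_on (sphere 0 1) (\<lambda>w. F (inverse w))"
    by (rule continuous_on_compose2[OF cF]) (auto intro!: continuous_intros simp: norm_inverse)
  moreover have "avg (\<lambda>w. 1) = 1"
    by (simp add: avg_def)
  ultimately have "avg F = 0"
    by (simp add: avg_diff avg_compose_inverse)
  then show ?thesis
    unfolding F_def using poly_nonzero_in_disc circle by blast
qed

section \<open>Laurent coefficients\<close>

text \<open>Multiplication by a power of \<open>w\<close> turns the sum into a polynomial with
  infinitely many zeros. This makes the description in \<open>laurent_coeff\<close> unique.\<close>

lemma laurent_coeffs_zero:
  fixes c :: "int \<Rightarrow> complex"
  assumes "finite A" "\<And>w. w \<noteq> 0 \<Longrightarrow> (\<Sum>n\<in>A. c n * w powi n) = 0" "n \<in> A"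
  shows "c n = 0"
proof -
  obtain N :: int where N: "\<And>n. n \<in> A \<Longrightarrow> - N \<le> n"
    using assms(1) by (metis Min_le minus_minus)
  define P where "P = (\<Sum>n\<in>A. monom (c n) (nat (n + N)))"
  have "poly P w = 0" if "w \<noteq> 0" for w
  proof -
    have "poly P w = (\<Sum>n\<in>A. w powi N * (c n * w powi n))"
      unfolding P_def poly_sum
    proof (rule sum.cong)
      fix n assume "n \<in> A"
      then have "w ^ nat (n + N) = w powi (n + N)"
        using N[of n] by (simp add: power_int_def)
      then show "poly (monom (c n) (nat (n + N))) w = w powi N * (c n * w powi n)"
        using that by (simp add: poly_monom power_int_add mult_ac)
    qed simp
    also have "\<dots> = w powi N * (\<Sum>n\<in>A. c n * w powi n)"
      by (simp add: sum_distrib_left)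
    also have "\<dots> = 0"
      using assms(2)[OF that] by simp
    finally show ?thesis .
  qed
  \<comment> \<open>The extra factor \<open>w\<close> covers the point 0, about which the hypothesis
    is silent.\<close>
  then have "poly (pCons 0 P) w = 0" for w
    by (cases "w = 0") auto
  then have "P = 0"
    using poly_all_0_iff_0[of "pCons 0 P"] by simp
  have "coeff P (nat (n + N)) = (\<Sum>m\<in>A. if m = n then c m else 0)"
    unfolding P_def coeff_sum coeff_monom
    using assms(3) N by (intro sum.cong) (auto dest!: N)
  then show ?thesis
    using assms(1,3) \<open>P = 0\<close> by simp
qed

lemma has_laurent_coeffs_sum:
  assumes "has_laurent_coeffs f c" "finite A" "{n. c n \<noteq> 0} \<subseteq> A" "w \<noteq> 0"
  shows "f w = (\<Sum>n\<in>A. c n * w powi n)"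
proof -
  have "f w = (\<Sum>n | c n \<noteq> 0. c n * w powi n)"
    using assms by (simp add: has_laurent_coeffs_def)
  also have "\<dots> = (\<Sum>n\<in>A. c n * w powi n)"
    using assms by (intro sum.mono_neutral_left) auto
  finally show ?thesis .
qed

lemma laurent_coeff_eqI:
  assumes "has_laurent_coeffs f c"
  shows "laurent_coeff f = c"
  unfolding laurent_coeff_def
proof (rule the_equality)
  fix c' assume c': "has_laurent_coeffs f c'"
  show "c' = c"
  proof
    fix n
    define A where "A = insert n ({n. c n \<noteq> 0} \<union> {n. c' n \<noteq> 0})"
    have fin: "finite A"
      using assms c' by (auto simp: A_def has_laurent_coeffs_def)
    have "(\<Sum>n\<in>A. (c' n - c n) * w powi n) = 0" if "w \<noteq> 0" for w
    proof -
      have "f w = (\<Sum>n\<in>A. c n * w powi n)" "f w = (\<Sum>n\<in>A. c' n * w powi n)"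
        using has_laurent_coeffs_sum[OF _ fin _ that] assms c' by (auto simp: A_def)
      then show ?thesis
        by (simp add: left_diff_distrib sum_subtractf)
    qed
    from laurent_coeffs_zero[OF fin this, of n] show "c' n = c n"
      by (simp add: A_def)
  qed
qed fact

lemma has_laurent_coeffs_poly:
  assumes "\<And>w. w \<noteq> 0 \<Longrightarrow> f w = w ^ k * poly P (inverse w)"
  shows "has_laurent_coeffs f (\<lambda>n. if n \<le> int k then coeff P (nat (int k - n)) else 0)"
proof -
  let ?c = "\<lambda>n. if n \<le> int k then coeff P (nat (int k - n)) else 0"
  let ?A = "(\<lambda>i. int k - int i) ` {..degree P}"
  have sub: "{n. ?c n \<noteq> 0} \<subseteq> ?A"
  proof
    fix n assume "n \<in> {n. ?c n \<noteq> 0}"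
    then have "n \<le> int k" "nat (int k - n) \<le> degree P"
      by (auto intro: le_degree split: if_splits)
    then show "n \<in> ?A"
      by (intro image_eqI[of _ _ "nat (int k - n)"]) auto
  qed
  have "f w = (\<Sum>n | ?c n \<noteq> 0. ?c n * w powi n)" if "w \<noteq> 0" for w
  proof -
    have "(\<Sum>n | ?c n \<noteq> 0. ?c n * w powi n) = (\<Sum>n\<in>?A. ?c n * w powi n)"
      using sub by (intro sum.mono_neutral_left) auto
    also have "\<dots> = (\<Sum>i\<le>degree P. coeff P i * w powi (int k - int i))"
      by (subst sum.reindex) (auto simp: inj_on_def)
    also have "\<dots> = (\<Sum>i\<le>degree P. w ^ k * (coeff P i * inverse w ^ i))"
      using that by (intro sum.cong) (auto simp: power_int_diff field_simps)
    also have "\<dots> = f w"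
      using assms[OF that] by (simp add: poly_altdef sum_distrib_left)
    finally show ?thesis by simp
  qed
  then show ?thesis
    unfolding has_laurent_coeffs_def using finite_subset[OF sub] by blast
qed

lemma has_laurent_coeffs_tilde:
  assumes "has_laurent_coeffs f c"
  shows "has_laurent_coeffs (tilde f) (\<lambda>n. cnj (c (- n)))"
proof -
  have set: "{n. cnj (c (- n)) \<noteq> 0} = uminus ` {n. c n \<noteq> 0}"
    by (auto simp: image_iff) (metis minus_minus)
  have "tilde f w = (\<Sum>n | cnj (c (- n)) \<noteq> 0. cnj (c (- n)) * w powi n)" if "w \<noteq> 0" for w
    unfolding set using assms that
    by (subst sum.reindex) (auto simp: tilde_def has_laurent_coeffs_def power_int_minus power_int_inverse
        intro!: sum.cong simp flip: complex_cnj_power_int)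
  then show ?thesis
    using assms unfolding has_laurent_coeffs_def set by auto
qed

lemma Laurent_parts:
  assumes f: "\<And>w. w \<noteq> 0 \<Longrightarrow> f w = w ^ k * poly P (inverse w)"
  shows "pos_part f w = hpos k P w" and "const_part f = coeff P k"
proof -
  let ?c = "\<lambda>n. if n \<le> int k then coeff P (nat (int k - n)) else 0"
  have c: "laurent_coeff f = ?c"
    by (rule laurent_coeff_eqI[OF has_laurent_coeffs_poly[OF f]])
  show "const_part f = coeff P k"
    by (simp add: const_part_def c)
  have "pos_part f w = (\<Sum>n\<in>(\<lambda>i. int k - int i) ` {..<k}. ?c n * w powi n)"
    unfolding pos_part_def c
  proof (rule sum.mono_neutral_left)
    show "{n. 0 < n \<and> ?c n \<noteq> 0} \<subseteq> (\<lambda>i. int k - int i) ` {..<k}"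
    proof
      fix n assume "n \<in> {n. 0 < n \<and> ?c n \<noteq> 0}"
      then have "0 < n" "n \<le> int k" by (auto split: if_splits)
      then show "n \<in> (\<lambda>i. int k - int i) ` {..<k}"
        by (intro image_eqI[of _ _ "nat (int k - n)"]) auto
    qed
  qed auto
  also have "\<dots> = (\<Sum>i<k. ?c (int k - int i) * w powi (int k - int i))"
    by (subst sum.reindex) (auto simp: inj_on_def)
  also have "\<dots> = hpos k P w"
    unfolding hpos_def by (intro sum.cong) (auto simp flip: of_nat_diff)
  finally show "pos_part f w = hpos k P w" .
qed

text \<open>\<open>tilde\<close> moves the conjugate of the coefficient of \<open>w\<^sup>n\<close>
  to \<open>w\<^sup>-\<^sup>n\<close>, so negative parts are reflected positive parts. Agreement of
  \<open>g\<close> with \<open>tilde f\<close> is asked only off 0, which is all that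
  \<open>ztilde\<close> provides.\<close>

lemma Laurent_parts_tilde:
  assumes f: "\<And>w. w \<noteq> 0 \<Longrightarrow> f w = w ^ k * poly P (inverse w)"
    and g: "\<And>w. w \<noteq> 0 \<Longrightarrow> g w = tilde f w" and w: "w \<noteq> 0"
  shows "neg_part g w = tilde (hpos k P) w" and "const_part g = cnj (coeff P k)"
proof -
  define c where "c = laurent_coeff f"
  have "has_laurent_coeffs f c"
    unfolding c_def using has_laurent_coeffs_poly[OF f] laurent_coeff_eqI by metis
  then have "has_laurent_coeffs (tilde f) (\<lambda>n. cnj (c (- n)))"
    by (rule has_laurent_coeffs_tilde)
  then have "has_laurent_coeffs g (\<lambda>n. cnj (c (- n)))"
    by (simp add: has_laurent_coeffs_def g)
  then have cg: "laurent_coeff g = (\<lambda>n. cnj (c (- n)))"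
    by (rule laurent_coeff_eqI)
  show "const_part g = cnj (coeff P k)"
    using Laurent_parts(2)[OF f] by (simp add: const_part_def cg c_def)
  have set: "{n. n < 0 \<and> cnj (c (- n)) \<noteq> 0} = uminus ` {n. n > 0 \<and> c n \<noteq> 0}"
    by (auto simp: image_iff) (metis minus_minus neg_0_less_iff_less)
  have "neg_part g w = tilde (pos_part f) w"
    unfolding neg_part_def cg set using w
    by (subst sum.reindex) (auto simp: tilde_def pos_part_def c_def power_int_minus power_int_inverse
        intro!: sum.cong simp flip: complex_cnj_power_int)
  also have "\<dots> = tilde (hpos k P) w"
    using Laurent_parts(1)[OF f] by (simp add: tilde_def)
  finally show "neg_part g w = tilde (hpos k P) w" .
qed

lemma hpart_has_field_derivative:
  assumes "w \<noteq> 0"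
  shows "(hpart k (q ^ k) has_field_derivative
    inverse w * hpos k (smult (of_nat k) (q ^ (k - 1) * euler q)) w) (at w)"
proof -
  have "(hpart k (q ^ k) has_field_derivative
      (\<Sum>i<k. coeff (q ^ k) i * (of_nat (k - i) * w ^ (k - i - 1)))) (at w)"
    unfolding hpart_def[abs_def] hpos_def by (auto intro!: derivative_eq_intros sum.cong simp: mult_ac)
  moreover have "(\<Sum>i<k. coeff (q ^ k) i * (of_nat (k - i) * w ^ (k - i - 1))) =
      inverse w * hpos k (smult (of_nat k) (q ^ (k - 1) * euler q)) w"
    unfolding hpos_def coeff_euler_power sum_distrib_left
  proof (rule sum.cong)
    fix i assume "i \<in> {..<k}"
    then obtain m where "k = i + Suc m"
      using less_imp_Suc_add by auto
    then show "coeff (q ^ k) i * (of_nat (k - i) * w ^ (k - i - 1)) =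
        inverse w * ((of_nat k - of_nat i) * coeff (q ^ k) i * w ^ (k - i))"
      using assms by simp
  qed simp
  ultimately show ?thesis by simp
qed

text \<open>The hypothesis is shaped so that \<open>D\<close> is \<open>\<theta>f\<close> at the
  reflected point; the conclusion is the sign rule
  \<open>\<theta>(f\<^sup>~) = - (\<theta>f)\<^sup>~\<close>.\<close>

lemma tilde_has_field_derivative:
  assumes "(f has_field_derivative inverse (inverse (cnj w)) * D) (at (inverse (cnj w)))" "w \<noteq> 0"
  shows "(tilde f has_field_derivative - (inverse w * cnj D)) (at w)"
proof -
  have "((cnj \<circ> f \<circ> cnj) has_field_derivative cnj (inverse (inverse (cnj w)) * D)) (at (inverse w))"
    using assms(1) by (intro has_field_derivative_cnj_cnj) simp
  from DERIV_chain2[OF this DERIV_inverse[OF assms(2)]]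
  have "((\<lambda>w. (cnj \<circ> f \<circ> cnj) (inverse w)) has_field_derivative - (inverse w * cnj D)) (at w)"
    by (rule DERIV_cong) (use assms(2) in \<open>simp add: field_simps\<close>)
  then show ?thesis
    by (simp add: tilde_def[abs_def] o_def)
qed

section \<open>Derivatives with respect to the moments\<close>

lemma shift_shift: "shift k c (shift k c t s) s' = shift k c t (s + s')"
  by (auto simp: shift_def fun_eq_iff algebra_simps)

lemma shift_0 [simp]: "shift k c t 0 = t"
  by (simp add: shift_def)

lemma continuous_on_shift: "continuous_on U (shift k c t)"
proof (rule continuous_on_coordinatewise_then_product)
  show "continuous_on U (\<lambda>s. shift k c t s i)" for i
    by (cases "i = k") (auto simp: shift_def intro!: continuous_intros)
qed

lemma shift_in_moment_space:
  assumes "t \<in> moment_space d" "(k, c) \<in> directions d"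
  shows "shift k c t s \<in> moment_space d"
  using assms by (auto simp: moment_space_def directions_def shift_def)

text \<open>The moment set is open only relative to \<open>moment_space d\<close>; the admissible
  directions stay in that space, so a whole interval of shifts remains in the set.\<close>

lemma moment_set_shift:
  assumes "small_enough d \<delta>" "t \<in> moment_set d \<delta>" "(k, c) \<in> directions d"
  obtains e where "e > 0" "\<And>s. s \<in> {-e..e} \<Longrightarrow> shift k c t s \<in> moment_set d \<delta>"
proof -
  have t: "t \<in> moment_space d"
    using assms(2) by (simp add: moment_set_def)
  obtain T where T: "open T" "moment_set d \<delta> = moment_space d \<inter> T"
    using assms(1) by (auto simp: small_enough_def openin_open)
  have "open (shift k c t -` T)"
    using T(1) continuous_on_shift by (rule open_vimage)
  moreover have "0 \<in> shift k c t -` T"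
    using assms(2) T by auto
  ultimately obtain e where e: "e > 0" "cball 0 e \<subseteq> shift k c t -` T"
    by (metis open_contains_cball)
  show ?thesis
  proof
    show "shift k c t s \<in> moment_set d \<delta>" if "s \<in> {-e..e}" for s
    proof -
      have "s \<in> cball 0 e" using that by auto
      then show ?thesis
        using e(2) shift_in_moment_space[OF t assms(3)] unfolding T(2) by blast
    qed
  qed fact
qed

text \<open>\<open>Cn_on\<close> gives differentiability at parameter 0 only. Starting the shift at
  \<open>shift k c t s\<close> instead of \<open>t\<close> and translating the parameter gives it at
  every \<open>s\<close>.\<close>

lemma smooth_on_moments_has_vector_derivative:
  assumes "smooth_on_moments d S F" "(k, c) \<in> directions d" "shift k c t s \<in> S"
  shows "((\<lambda>s. F (shift k c t s)) has_vector_derivative partial_deriv k c F (shift k c t s)) (at s)"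
proof -
  have "Cn_on d (Suc 0) S F"
    using assms(1) by (simp only: smooth_on_moments_def)
  then have "(\<lambda>\<sigma>. F (shift k c (shift k c t s) \<sigma>)) differentiable (at 0)"
    using assms by auto
  then have "((\<lambda>\<sigma>. F (shift k c (shift k c t s) \<sigma>)) has_vector_derivative partial_deriv k c F (shift k c t s)) (at (s - s))"
    by (simp add: vector_derivative_works partial_deriv_def)
  moreover have "((\<lambda>s'. s' - s) has_vector_derivative 1) (at s)"
    by (auto intro!: derivative_eq_intros)
  ultimately have "((\<lambda>\<sigma>. F (shift k c (shift k c t s) \<sigma>)) \<circ> (\<lambda>s'. s' - s) has_vector_derivative
      1 *\<^sub>R partial_deriv k c F (shift k c t s)) (at s)"
    by (intro vector_diff_chain_at)
  then show ?thesis
    by (simp add: o_def shift_shift)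
qed

lemma smooth_on_moments_continuous_partial:
  assumes "smooth_on_moments d S F" "(k, c) \<in> directions d"
  shows "continuous_on S (partial_deriv k c F)"
proof -
  have "Cn_on d (Suc 0) S F"
    using assms(1) by (simp only: smooth_on_moments_def)
  then show ?thesis
    using assms by auto
qed

definition moment_poly :: "nat \<Rightarrow> (nat \<Rightarrow> complex) \<Rightarrow> complex poly" where
  "moment_poly d t = curve_poly (curve_of d t)"

definition moment_poly_deriv :: "nat \<Rightarrow> nat \<Rightarrow> complex \<Rightarrow> (nat \<Rightarrow> complex) \<Rightarrow> complex poly" where
  "moment_poly_deriv d k c t = pCons (of_real (partial_deriv k c (\<lambda>t. fst (curve_of d t)) t))
     (\<Sum>i\<le>d. monom (partial_deriv k c (\<lambda>t. coeff (snd (curve_of d t)) i) t) i)"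

lemma coeff_moment_poly_deriv:
  "coeff (moment_poly_deriv d k c t) 0 = of_real (partial_deriv k c (\<lambda>t. fst (curve_of d t)) t)"
  "coeff (moment_poly_deriv d k c t) (Suc i) =
     (if i \<le> d then partial_deriv k c (\<lambda>t. coeff (snd (curve_of d t)) i) t else 0)"
  by (simp_all add: moment_poly_deriv_def coeff_sum)

lemma curve_with_moments_curve_of:
  assumes "small_enough d \<delta>" "t \<in> moment_set d \<delta>"
  shows "curve_with_moments d t (curve_of d t)"
proof -
  have "\<exists>!\<gamma>. curve_with_moments d t \<gamma>"
    using assms unfolding small_enough_def by blast
  then show ?thesis
    unfolding curve_of_def by (rule theI')
qed

lemma poly_path_moment_poly:
  assumes small: "small_enough d \<delta>" and dir: "(k, c) \<in> directions d"
    and U: "\<And>s. s \<in> U \<Longrightarrow> shift k c t s \<in> moment_set d \<delta>"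
  shows "poly_path (d + 1) U (\<lambda>s. moment_poly d (shift k c t s)) (\<lambda>s. moment_poly_deriv d k c (shift k c t s))"
  unfolding poly_path_def
proof (intro ballI conjI allI)
  let ?q = "\<lambda>s. moment_poly d (shift k c t s)" and ?q' = "\<lambda>s. moment_poly_deriv d k c (shift k c t s)"
  have smooth: "smooth_on_moments d (moment_set d \<delta>) (\<lambda>t. fst (curve_of d t))"
    "i \<le> d \<Longrightarrow> smooth_on_moments d (moment_set d \<delta>) (\<lambda>t. coeff (snd (curve_of d t)) i)" for i
    using small unfolding small_enough_def by blast+
  have deg: "degree (snd (curve_of d (shift k c t s))) \<le> d" if "s \<in> U" for s
    using curve_with_moments_curve_of[OF small U[OF that]]
    by (simp add: curve_with_moments_def polynomial_curve_def)
  show "degree (?q s) \<le> d + 1" if "s \<in> U" for s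
    using deg[OF that] by (simp add: moment_poly_def curve_poly_def degree_pCons_le[THEN order_trans])
  show "degree (?q' s) \<le> d + 1" if "s \<in> U" for s
  proof (rule degree_le, intro allI impI)
    fix i assume "d + 1 < i"
    then show "coeff (?q' s) i = 0"
      by (cases i) (auto simp: coeff_moment_poly_deriv)
  qed
  show "((\<lambda>s. coeff (?q s) i) has_vector_derivative coeff (?q' s) i) (at s within U)" if s: "s \<in> U" for s i
  proof (cases i)
    case 0
    have "((\<lambda>s. of_real (fst (curve_of d (shift k c t s)))) has_vector_derivative
        complex_of_real (partial_deriv k c (\<lambda>t. fst (curve_of d t)) (shift k c t s))) (at s)"
      by (rule bounded_linear.has_vector_derivative[OF bounded_linear_of_real
            smooth_on_moments_has_vector_derivative[OF smooth(1) dir U[OF s]]])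
    then show ?thesis
      unfolding 0 coeff_moment_poly_deriv
      by (auto simp: moment_poly_def curve_poly_def intro: has_vector_derivative_at_within)
  next
    case (Suc n)
    show ?thesis
    proof (cases "n \<le> d")
      case True
      from smooth_on_moments_has_vector_derivative[OF smooth(2)[OF this] dir U[OF s]] True show ?thesis
        unfolding Suc coeff_moment_poly_deriv
        by (auto simp: moment_poly_def curve_poly_def intro: has_vector_derivative_at_within)
    next
      case False
      have "((\<lambda>s. 0 :: complex) has_vector_derivative 0) (at s within U)"
        by simp
      then have "((\<lambda>s. coeff (?q s) i) has_vector_derivative 0) (at s within U)"
        by (rule has_vector_derivative_transform[OF s, rotated])
           (use False deg in \<open>auto simp: Suc moment_poly_def curve_poly_def intro!: coeff_eq_0 dest: deg\<close>)
      then show ?thesis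
        using False by (simp add: Suc coeff_moment_poly_deriv)
    qed
  qed
  have cont: "continuous_on U (\<lambda>s. partial_deriv k c F (shift k c t s))"
    if "smooth_on_moments d (moment_set d \<delta>) F" for F :: "(nat \<Rightarrow> complex) \<Rightarrow> 'z :: real_normed_vector"
    using U by (intro continuous_on_compose2[OF smooth_on_moments_continuous_partial[OF that dir] continuous_on_shift]) auto
  show "continuous_on U (\<lambda>s. coeff (?q' s) i)" for i
  proof (cases i)
    case 0
    show ?thesis
      unfolding 0 coeff_moment_poly_deriv by (intro continuous_intros cont smooth)
  next
    case (Suc n)
    show ?thesis
      unfolding Suc coeff_moment_poly_deriv by (cases "n \<le> d") (auto intro: cont smooth)
  qed
qed

text \<open>Area and exterior moments become one family; the factor is 1 rather than
  \<open>n\<close> at index 0, where the area formula is used.\<close>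

lemma curve_with_moments_moment:
  assumes "curve_with_moments d t \<gamma>"
  shows "moment (curve_poly \<gamma>) n = (if n = 0 then 1 else of_nat n) * t n"
proof (cases "n = 0")
  case True
  then show ?thesis
    using assms enclosed_area_eq[of d \<gamma>] by (auto simp: curve_with_moments_def)
next
  case False
  then show ?thesis
    using assms ext_moment_eq[of n \<gamma>] by (auto simp: curve_with_moments_def)
qed

section \<open>The functions of the theorem in polynomial form\<close>

lemma zfun_eq: "w \<noteq> 0 \<Longrightarrow> zfun d w s = zpol (moment_poly d s) w"
  by (simp add: zfun_def moment_poly_def param_eq_zpol)

lemma ztilde_eq: "w \<noteq> 0 \<Longrightarrow> ztilde d w s = tilde (zpol (moment_poly d s)) w"
  by (simp add: ztilde_def conj_fun_def tilde_def moment_poly_def param_eq_zpol)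

lemma poisson_eq:
  "poisson f g w t =
    (w * deriv (\<lambda>u. f u t) w) * d_t0 (g w) t - d_t0 (f w) t * (w * deriv (\<lambda>u. g u t) w)"
  by (simp add: poisson_def mult_ac)

lemma coeff_mult_has_vector_derivative:
  fixes p q :: "real \<Rightarrow> complex poly"
  assumes "\<And>i. ((\<lambda>s. coeff (p s) i) has_vector_derivative coeff p' i) (at x)"
    and "\<And>i. ((\<lambda>s. coeff (q s) i) has_vector_derivative coeff q' i) (at x)"
  shows "((\<lambda>s. coeff (p s * q s) i) has_vector_derivative coeff (p x * q' + p' * q x) i) (at x)"
  unfolding coeff_add coeff_mult sum.distrib[symmetric]
  by (intro has_vector_derivative_sum has_vector_derivative_mult assms)

lemma coeff_power_has_vector_derivative:
  fixes q :: "real \<Rightarrow> complex poly"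
  assumes "\<And>i. ((\<lambda>s. coeff (q s) i) has_vector_derivative coeff q' i) (at x)"
  shows "((\<lambda>s. coeff (q s ^ n) i) has_vector_derivative coeff (smult (of_nat n) (q x ^ (n - 1) * q')) i) (at x)"
proof (induction n arbitrary: i)
  case (Suc n)
  have "q x * smult (of_nat n) (q x ^ (n - 1) * q') = smult (of_nat n) (q x ^ n * q')"
    by (cases n) (simp_all add: mult_ac)
  then have "q x * smult (of_nat n) (q x ^ (n - 1) * q') + q' * q x ^ n =
      smult (of_nat (Suc n)) (q x ^ (Suc n - 1) * q')"
    by (simp add: smult_add_left mult.commute)
  then show ?case
    using coeff_mult_has_vector_derivative[OF assms Suc, of i] by simp
qed simp

lemma hpart_has_vector_derivative:
  assumes "\<And>i. ((\<lambda>s. coeff (P s) i) has_vector_derivative coeff P' i) (at x)"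
  shows "((\<lambda>s. hpart k (P s) w) has_vector_derivative hpart k P' w) (at x)"
proof -
  have "((\<lambda>s. coeff (P s) k * (1 / 2)) has_vector_derivative coeff P' k * (1 / 2)) (at x)"
    by (intro has_vector_derivative_mult_left assms)
  then show ?thesis
    unfolding hpart_def hpos_def
    by (intro has_vector_derivative_add has_vector_derivative_sum has_vector_derivative_mult_left assms) simp
qed

lemma Mfun_eq: "Mfun d k w s = hpart k (moment_poly d s ^ k) w"
proof -
  have "zfun d u s ^ k = u ^ k * poly (moment_poly d s ^ k) (inverse u)" if "u \<noteq> 0" for u
    using that by (simp add: zfun_eq zpol_def power_mult_distrib)
  from Laurent_parts[OF this] show ?thesis
    by (simp add: Mfun_def hpart_def)
qed

lemma Mtilde_eq:
  assumes "w \<noteq> 0"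
  shows "Mtilde d k w s = tilde (hpart k (moment_poly d s ^ k)) w"
proof -
  have f: "zpol (moment_poly d s) u ^ k = u ^ k * poly (moment_poly d s ^ k) (inverse u)" if "u \<noteq> 0" for u
    using that by (simp add: zpol_def power_mult_distrib)
  have "ztilde d u s ^ k = tilde (\<lambda>u. zpol (moment_poly d s) u ^ k) u" if "u \<noteq> 0" for u
    using that by (simp add: ztilde_eq tilde_def)
  from Laurent_parts_tilde[OF f this assms] show ?thesis
    by (simp add: Mtilde_def hpart_def tilde_def)
qed

lemma at_0_within: "e > 0 \<Longrightarrow> at (0::real) within {-e..e} = at 0"
  by (rule at_within_interior) (simp add: interior_atLeastAtMost_real)

text \<open>For \<open>zfun\<close>, \<open>ztilde\<close> and \<open>Mtilde\<close> the polynomial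
  forms are available only off 0, hence the passage through equality near \<open>w\<close>. The two
  reflected functions acquire a minus sign.\<close>

lemma deriv_zfun_Mfun:
  assumes w: "w \<noteq> 0"
  shows "w * deriv (\<lambda>u. zfun d u t) w = zpol (euler (moment_poly d t)) w"
    and "w * deriv (\<lambda>u. ztilde d u t) w = - tilde (zpol (euler (moment_poly d t))) w"
    and "w * deriv (\<lambda>u. Mfun d k u t) w =
      hpos k (smult (of_nat k) (moment_poly d t ^ (k - 1) * euler (moment_poly d t))) w"
    and "w * deriv (\<lambda>u. Mtilde d k u t) w =
      - tilde (hpos k (smult (of_nat k) (moment_poly d t ^ (k - 1) * euler (moment_poly d t)))) w"
proof -
  have ev: "eventually (\<lambda>u. u \<noteq> 0) (nhds w)"
    using w by (rule t1_space_nhds)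
  have "deriv (\<lambda>u. zfun d u t) w = deriv (zpol (moment_poly d t)) w"
    by (rule deriv_cong_ev[OF eventually_mono[OF ev]]) (simp_all add: zfun_eq)
  then show "w * deriv (\<lambda>u. zfun d u t) w = zpol (euler (moment_poly d t)) w"
    using DERIV_imp_deriv[OF zpol_has_field_derivative[OF w]] w by simp
  have "deriv (\<lambda>u. ztilde d u t) w = deriv (tilde (zpol (moment_poly d t))) w"
    by (rule deriv_cong_ev[OF eventually_mono[OF ev]]) (simp_all add: ztilde_eq)
  then show "w * deriv (\<lambda>u. ztilde d u t) w = - tilde (zpol (euler (moment_poly d t))) w"
    using DERIV_imp_deriv[OF tilde_zpol_has_field_derivative[OF w]] w by simp
  show "w * deriv (\<lambda>u. Mfun d k u t) w =
      hpos k (smult (of_nat k) (moment_poly d t ^ (k - 1) * euler (moment_poly d t))) w"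
    unfolding Mfun_eq using DERIV_imp_deriv[OF hpart_has_field_derivative[OF w]] w by simp
  have "deriv (\<lambda>u. Mtilde d k u t) w = deriv (tilde (hpart k (moment_poly d t ^ k))) w"
    by (rule deriv_cong_ev[OF eventually_mono[OF ev]]) (simp_all add: Mtilde_eq)
  moreover have "(tilde (hpart k (moment_poly d t ^ k)) has_field_derivative
      - (inverse w * cnj (hpos k (smult (of_nat k) (moment_poly d t ^ (k - 1) * euler (moment_poly d t))) (inverse (cnj w))))) (at w)"
    using w by (intro tilde_has_field_derivative hpart_has_field_derivative) auto
  ultimately show "w * deriv (\<lambda>u. Mtilde d k u t) w =
      - tilde (hpos k (smult (of_nat k) (moment_poly d t ^ (k - 1) * euler (moment_poly d t)))) w"
    using w by (simp add: DERIV_imp_deriv tilde_def)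
qed

section \<open>Derivatives at a fixed admissible moment sequence\<close>

context
  fixes d :: nat and \<delta> :: "complex list \<Rightarrow> real" and t :: "nat \<Rightarrow> complex"
  assumes small: "small_enough d \<delta>" and t: "t \<in> moment_set d \<delta>"
begin

lemma moment_poly_path:
  assumes dir: "(k, c) \<in> directions d"
  obtains e where "e > 0" "\<And>s. s \<in> {-e..e} \<Longrightarrow> shift k c t s \<in> moment_set d \<delta>"
    "poly_path (d + 1) {-e..e} (\<lambda>s. moment_poly d (shift k c t s)) (\<lambda>s. moment_poly_deriv d k c (shift k c t s))"
proof -
  obtain e where "e > 0" "\<And>s. s \<in> {-e..e} \<Longrightarrow> shift k c t s \<in> moment_set d \<delta>"
    by (rule moment_set_shift[OF small t dir]) blast
  then show thesis
    using that[of e] poly_path_moment_poly[OF small dir] by blast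
qed

lemma moment_poly_nonzero: "\<forall>u. norm u \<le> 1 \<longrightarrow> poly (moment_poly d t) u \<noteq> 0"
  using curve_with_moments_curve_of[OF small t] unfolding moment_poly_def
  by (intro curve_poly_nonzero) (auto simp: curve_with_moments_def)

text \<open>Along a shift the moments are known explicitly: the \<open>k\<close>-th moves with
  velocity \<open>c\<close>, up to its factor, and the others are constant. Comparison with the
  variation formula evaluates the averages.\<close>

lemma avg_pairing:
  assumes dir: "(k, c) \<in> directions d"
  shows "avg (\<lambda>w. pairing (moment_poly d t) (moment_poly_deriv d k c t) (moment_poly_deriv d k c t) w *
      inverse (zpol (moment_poly d t) w) ^ n) = (if n = k then (if k = 0 then 1 else of_nat k) * c else 0)"
proof -
  obtain e where e: "e > 0" "\<And>s. s \<in> {-e..e} \<Longrightarrow> shift k c t s \<in> moment_set d \<delta>"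
    and path: "poly_path (d + 1) {-e..e} (\<lambda>s. moment_poly d (shift k c t s)) (\<lambda>s. moment_poly_deriv d k c (shift k c t s))"
    using moment_poly_path[OF dir] by blast
  have nz: "zpol (moment_poly d (shift k c t s)) w \<noteq> 0" if "s \<in> {-e..e}" "norm w = 1" for s w
  proof -
    have "poly (curve_poly (curve_of d (shift k c t s))) (inverse w) \<noteq> 0"
      using curve_with_moments_curve_of[OF small e(2)[OF that(1)]] that(2) curve_poly_nonzero
      by (auto simp: curve_with_moments_def norm_inverse)
    then show ?thesis
      using that(2) by (auto simp: zpol_def moment_poly_def)
  qed
  let ?c = "if n = 0 then 1 else of_nat n :: complex"
  have "((\<lambda>s. moment (moment_poly d (shift k c t s)) n) has_vector_derivative
      avg (\<lambda>w. pairing (moment_poly d (shift k c t 0)) (moment_poly_deriv d k c (shift k c t 0)) (moment_poly_deriv d k c (shift k c t 0)) w *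
      inverse (zpol (moment_poly d (shift k c t 0)) w) ^ n)) (at 0 within {-e..e})"
    by (rule moment_has_vector_derivative[OF path]) (use e(1) nz in auto)
  then have 1: "((\<lambda>s. moment (moment_poly d (shift k c t s)) n) has_vector_derivative
      avg (\<lambda>w. pairing (moment_poly d t) (moment_poly_deriv d k c t) (moment_poly_deriv d k c t) w *
      inverse (zpol (moment_poly d t) w) ^ n)) (at 0 within {-e..e})"
    by simp
  have "((\<lambda>s. ?c * shift k c t s n) has_vector_derivative ?c * (if n = k then c else 0)) (at 0 within {-e..e})"
    by (cases "n = k") (auto simp: shift_def intro!: derivative_eq_intros)
  then have 2: "((\<lambda>s. moment (moment_poly d (shift k c t s)) n) has_vector_derivative ?c * (if n = k then c else 0)) (at 0 within {-e..e})"
    by (rule has_vector_derivative_transform[rotated 2])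
       (use e curve_with_moments_moment[OF curve_with_moments_curve_of[OF small]] in \<open>auto simp: moment_poly_def\<close>)
  have "avg (\<lambda>w. pairing (moment_poly d t) (moment_poly_deriv d k c t) (moment_poly_deriv d k c t) w *
      inverse (zpol (moment_poly d t) w) ^ n) = ?c * (if n = k then c else 0)"
    using 1 2 unfolding at_0_within[OF e(1)] by (rule vector_derivative_unique_at)
  then show ?thesis by auto
qed

lemma partial_deriv_zfun:
  assumes dir: "(k, c) \<in> directions d" and w: "w \<noteq> 0"
  shows "partial_deriv k c (zfun d w) t = zpol (moment_poly_deriv d k c t) w"
    and "partial_deriv k c (ztilde d w) t = tilde (zpol (moment_poly_deriv d k c t)) w"
proof -
  obtain e where e: "e > 0"
    and path: "poly_path (d + 1) {-e..e} (\<lambda>s. moment_poly d (shift k c t s)) (\<lambda>s. moment_poly_deriv d k c (shift k c t s))"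
    using moment_poly_path[OF dir] by blast
  have "0 \<in> {-e..e}" using e by simp
  from vector_derivative_at[OF poly_path_zpol[OF path this, of w, unfolded at_0_within[OF e] shift_0]]
  show "partial_deriv k c (zfun d w) t = zpol (moment_poly_deriv d k c t) w"
    unfolding partial_deriv_def zfun_eq[OF w] .
  from vector_derivative_at[OF poly_path_tilde[OF path \<open>0 \<in> _\<close>, of w, unfolded at_0_within[OF e] shift_0]]
  show "partial_deriv k c (ztilde d w) t = tilde (zpol (moment_poly_deriv d k c t)) w"
    unfolding partial_deriv_def ztilde_eq[OF w] .
qed

lemma d_t0_Mfun:
  assumes w: "w \<noteq> 0"
  shows "d_t0 (Mfun d k w) t = hpart k (smult (of_nat k) (moment_poly d t ^ (k - 1) * moment_poly_deriv d 0 1 t)) w"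
    and "d_t0 (Mtilde d k w) t =
      tilde (hpart k (smult (of_nat k) (moment_poly d t ^ (k - 1) * moment_poly_deriv d 0 1 t))) w"
proof -
  let ?P' = "smult (of_nat k) (moment_poly d t ^ (k - 1) * moment_poly_deriv d 0 1 t)"
  have dir: "(0, 1) \<in> directions d"
    by (simp add: directions_def)
  obtain e where e: "e > 0"
    and path: "poly_path (d + 1) {-e..e} (\<lambda>s. moment_poly d (shift 0 1 t s)) (\<lambda>s. moment_poly_deriv d 0 1 (shift 0 1 t s))"
    using moment_poly_path[OF dir] by blast
  have "((\<lambda>s. coeff (moment_poly d (shift 0 1 t s)) i) has_vector_derivative
      coeff (moment_poly_deriv d 0 1 t) i) (at 0)" for i
  proof -
    have "((\<lambda>s. coeff (moment_poly d (shift 0 1 t s)) i) has_vector_derivative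
        coeff (moment_poly_deriv d 0 1 (shift 0 1 t 0)) i) (at 0 within {-e..e})"
      using path e unfolding poly_path_def by (metis atLeastAtMost_iff less_imp_le neg_le_0_iff_le)
    then show ?thesis
      unfolding at_0_within[OF e] shift_0 .
  qed
  from coeff_power_has_vector_derivative[OF this, of k]
  have "((\<lambda>s. coeff (moment_poly d (shift 0 1 t s) ^ k) i) has_vector_derivative coeff ?P' i) (at 0)" for i
    unfolding shift_0 .
  note deriv = hpart_has_vector_derivative[OF this]
  show "d_t0 (Mfun d k w) t = hpart k ?P' w"
    unfolding d_t0_def partial_deriv_def Mfun_eq by (rule vector_derivative_at[OF deriv])
  show "d_t0 (Mtilde d k w) t = tilde (hpart k ?P') w"
    unfolding d_t0_def partial_deriv_def Mtilde_eq[OF w] tilde_def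
    by (rule vector_derivative_at[OF bounded_linear.has_vector_derivative[OF bounded_linear_cnj deriv]])
qed

text \<open>The polynomials of \<open>\<partial>z/\<partial>t\<^sub>k\<close> and, next, of the
  conjugate derivative. As \<open>tilde\<close> is antilinear,
  \<open>\<partial>z\<^sup>~/\<partial>t\<^sub>k\<close> is the reflection of the latter.\<close>

definition wirtinger where
  "wirtinger k = smult (1 / 2) (moment_poly_deriv d k 1 t - smult \<i> (moment_poly_deriv d k \<i> t))"

definition wirtinger_bar where
  "wirtinger_bar k = smult (1 / 2) (moment_poly_deriv d k 1 t + smult \<i> (moment_poly_deriv d k \<i> t))"

lemma d_t_zfun:
  assumes k: "k \<in> {1..d + 1}" and w: "w \<noteq> 0"
  shows "d_t k (zfun d w) t = zpol (wirtinger k) w"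
    and "d_t k (ztilde d w) t = tilde (zpol (wirtinger_bar k)) w"
    and "d_tbar k (zfun d w) t = zpol (wirtinger_bar k) w"
    and "d_tbar k (ztilde d w) t = tilde (zpol (wirtinger k)) w"
proof -
  have "(k, 1) \<in> directions d" "(k, \<i>) \<in> directions d"
    using k by (auto simp: directions_def)
  note D = partial_deriv_zfun[OF this(1) w] partial_deriv_zfun[OF this(2) w]
  show "d_t k (zfun d w) t = zpol (wirtinger k) w"
    and "d_t k (ztilde d w) t = tilde (zpol (wirtinger_bar k)) w"
    and "d_tbar k (zfun d w) t = zpol (wirtinger_bar k) w"
    and "d_tbar k (ztilde d w) t = tilde (zpol (wirtinger k)) w"
    by (simp_all add: d_t_def d_tbar_def D wirtinger_def wirtinger_bar_def zpol_def tilde_def algebra_simps diff_divide_distrib add_divide_distrib)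
qed

text \<open>\<open>pairing\<close> is linear in its second argument and antilinear in its third, so
  opposite Wirtinger combinations in the two slots produce the same coefficients.\<close>

lemma pairing_wirtinger:
  shows "pairing q (wirtinger k) (wirtinger_bar k) w =
      1 / 2 * pairing q (moment_poly_deriv d k 1 t) (moment_poly_deriv d k 1 t) w -
      \<i> / 2 * pairing q (moment_poly_deriv d k \<i> t) (moment_poly_deriv d k \<i> t) w"
    and "pairing q (wirtinger_bar k) (wirtinger k) w =
      1 / 2 * pairing q (moment_poly_deriv d k 1 t) (moment_poly_deriv d k 1 t) w +
      \<i> / 2 * pairing q (moment_poly_deriv d k \<i> t) (moment_poly_deriv d k \<i> t) w"
  by (simp_all add: pairing_def wirtinger_def wirtinger_bar_def zpol_def tilde_def field_simps)

text \<open>The velocities 1 and \<open>\<i>\<close> combine to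
  \<open>(1 - \<i> * \<i>) / 2 = 1\<close> and \<open>(1 + \<i> * \<i>) / 2 = 0\<close>: the
  \<open>k\<close>-th moment is \<open>t\<^sub>k\<close> itself, up to its factor, without
  dependence on its conjugate.\<close>

lemma avg_pairing_wirtinger:
  assumes k: "k \<in> {1..d + 1}"
  shows "avg (\<lambda>w. pairing (moment_poly d t) (wirtinger k) (wirtinger_bar k) w * inverse (zpol (moment_poly d t) w) ^ n) =
      (if n = k then of_nat k else 0)"
    and "avg (\<lambda>w. pairing (moment_poly d t) (wirtinger_bar k) (wirtinger k) w * inverse (zpol (moment_poly d t) w) ^ n) = 0"
proof -
  have "(k, 1) \<in> directions d" "(k, \<i>) \<in> directions d" "k \<noteq> 0"
    using k by (auto simp: directions_def)
  note A = avg_pairing[OF this(1)] avg_pairing[OF this(2)]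
  define F where "F = (\<lambda>c w. pairing (moment_poly d t) (moment_poly_deriv d k c t) (moment_poly_deriv d k c t) w *
      inverse (zpol (moment_poly d t) w) ^ n)"
  have cF: "continuous_on (sphere 0 1) (F c)" for c
    unfolding F_def by (intro continuous_intros continuous_on_pairing continuous_on_inverse_zpol moment_poly_nonzero) simp
  have avgF: "avg (F 1) = (if n = k then of_nat k else 0)" "avg (F \<i>) = (if n = k then of_nat k * \<i> else 0)"
    using A[of n] \<open>k \<noteq> 0\<close> by (simp_all add: F_def)
  have "avg (\<lambda>w. pairing (moment_poly d t) (wirtinger k) (wirtinger_bar k) w * inverse (zpol (moment_poly d t) w) ^ n) =
      avg (\<lambda>w. 1 / 2 * F 1 w - \<i> / 2 * F \<i> w)"
    unfolding pairing_wirtinger F_def by (simp only: left_diff_distrib mult.assoc)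
  also have "\<dots> = 1 / 2 * avg (F 1) - \<i> / 2 * avg (F \<i>)"
    by (subst avg_diff) (auto simp only: avg_cmult intro!: continuous_intros cF)
  finally show "avg (\<lambda>w. pairing (moment_poly d t) (wirtinger k) (wirtinger_bar k) w * inverse (zpol (moment_poly d t) w) ^ n) =
      (if n = k then of_nat k else 0)"
    by (simp add: avgF mult.commute[of _ \<i>])
  have "avg (\<lambda>w. pairing (moment_poly d t) (wirtinger_bar k) (wirtinger k) w * inverse (zpol (moment_poly d t) w) ^ n) =
      avg (\<lambda>w. 1 / 2 * F 1 w + \<i> / 2 * F \<i> w)"
    unfolding pairing_wirtinger F_def by (simp only: distrib_right mult.assoc)
  also have "\<dots> = 1 / 2 * avg (F 1) + \<i> / 2 * avg (F \<i>)"
    by (subst avg_add) (auto simp only: avg_cmult intro!: continuous_intros cF)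
  finally show "avg (\<lambda>w. pairing (moment_poly d t) (wirtinger_bar k) (wirtinger k) w * inverse (zpol (moment_poly d t) w) ^ n) = 0"
    by (simp add: avgF mult.commute[of _ \<i>])
qed

lemma Lax_equations_moments:
  assumes k: "k \<in> {1..d + 1}" and w: "w \<noteq> 0"
  defines "q \<equiv> moment_poly d t" and "p \<equiv> moment_poly_deriv d 0 1 t"
  defines "M \<equiv> hpos k (smult (of_nat k) (q ^ (k - 1) * euler q))"
    and "D \<equiv> hpart k (smult (of_nat k) (q ^ (k - 1) * p))"
  shows "zpol (wirtinger k) w = M w * zpol p w - D w * zpol (euler q) w"
    and "tilde (zpol (wirtinger_bar k)) w = M w * tilde (zpol p) w + D w * tilde (zpol (euler q)) w"
proof -
  note nz = moment_poly_nonzero[folded q_def]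
  have k1: "k \<ge> 1" using k by simp
  have c0: "coeff q 0 \<noteq> 0" "cnj (coeff q 0) = coeff q 0"
    using nz[rule_format, of 0] by (auto simp: poly_0_coeff_0 q_def moment_poly_def curve_poly_def)
  \<comment> \<open>The coefficient \<open>r\<close> is real, hence so are its partial derivatives,
    and the two Wirtinger combinations have conjugate leading coefficients.\<close>
  have c1: "coeff (wirtinger_bar k) 0 = cnj (coeff (wirtinger k) 0)"
    by (simp add: wirtinger_def wirtinger_bar_def coeff_moment_poly_deriv)
  have "(0, 1) \<in> directions d" by (simp add: directions_def)
  from pairing_tendsto_1[OF nz] avg_pairing[OF this]
  have string: "(pairing q p p \<longlongrightarrow> 1) at_infinity"
    by (simp add: q_def p_def)
  have inf: "((\<lambda>w. pairing q (wirtinger k) (wirtinger_bar k) w - of_nat k * zpol q w ^ (k - 1) * zpol (euler q) w) \<longlongrightarrow> 0) at_infinity"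
    using avg_pairing_wirtinger(1)[OF k] by (intro pairing_tendsto_power[OF nz k1]) (simp add: q_def)
  have inf': "(pairing q (wirtinger_bar k) (wirtinger k) \<longlongrightarrow> 0) at_infinity"
    using avg_pairing_wirtinger(2)[OF k] by (intro pairing_tendsto_0[OF nz]) (simp add: q_def)
  show "zpol (wirtinger k) w = M w * zpol p w - D w * zpol (euler q) w"
    and "tilde (zpol (wirtinger_bar k)) w = M w * tilde (zpol p) w + D w * tilde (zpol (euler q)) w"
    unfolding M_def D_def
    using Lax_equations[OF k1 c0 c1 string inf inf' w] by blast+
qed

end

theorem proposition2p18:
  fixes d :: nat and \<delta> :: "complex list \<Rightarrow> real"
  assumes "small_enough d \<delta>"
  shows "\<forall>t \<in> moment_set d \<delta>. \<forall>w. w \<noteq> 0 \<longrightarrow> (\<forall>k\<in>{1..d+1}.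
     d_t k (zfun d w) t = poisson (Mfun d k) (zfun d) w t \<and>
     d_t k (ztilde d w) t = poisson (Mfun d k) (ztilde d) w t \<and>
     d_tbar k (zfun d w) t = poisson (zfun d) (Mtilde d k) w t \<and>
     d_tbar k (ztilde d w) t = poisson (ztilde d) (Mtilde d k) w t)"
proof (intro ballI allI impI)
  fix t and w :: complex and k
  assume t: "t \<in> moment_set d \<delta>" and w: "w \<noteq> 0" and k: "k \<in> {1..d + 1}"
  note ctx = assms t
  \<comment> \<open>The equations in the conjugate variables are the conjugates of the others at the
    reflected point. The sign change of \<open>\<theta>\<close> under reflection accounts for the
    exchanged arguments of the bracket.\<close>
  let ?w = "inverse (cnj w)"
  have w': "?w \<noteq> 0" using w by simp
  have "(0, 1) \<in> directions d" by (simp add: directions_def)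
  note d0 = partial_deriv_zfun[OF ctx this w, folded d_t0_def]
  have 3: "zpol (wirtinger_bar d t k) w =
      cnj (tilde (zpol (wirtinger_bar d t k)) ?w)"
    and 4: "tilde (zpol (wirtinger d t k)) w = cnj (zpol (wirtinger d t k) ?w)"
    by (simp_all add: tilde_def)
  have tilde': "cnj (f ?w) = tilde f w" "cnj (tilde f ?w) = f w" for f
    by (simp_all add: tilde_def)
  note L = Lax_equations_moments[OF ctx k w] Lax_equations_moments[OF ctx k w']
  have "d_t k (zfun d w) t = poisson (Mfun d k) (zfun d) w t"
    unfolding poisson_eq deriv_zfun_Mfun[OF w] d_t0_Mfun[OF ctx w] d0 d_t_zfun[OF ctx k w] L(1) ..
  moreover have "d_t k (ztilde d w) t = poisson (Mfun d k) (ztilde d) w t"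
    unfolding poisson_eq deriv_zfun_Mfun[OF w] d_t0_Mfun[OF ctx w] d0 d_t_zfun[OF ctx k w] L(2) by simp
  moreover have "d_tbar k (zfun d w) t = poisson (zfun d) (Mtilde d k) w t"
    unfolding poisson_eq deriv_zfun_Mfun[OF w] d_t0_Mfun[OF ctx w] d0 d_t_zfun[OF ctx k w] 3 L(4)
    by (simp only: complex_cnj_add complex_cnj_mult tilde') simp
  moreover have "d_tbar k (ztilde d w) t = poisson (ztilde d) (Mtilde d k) w t"
    unfolding poisson_eq deriv_zfun_Mfun[OF w] d_t0_Mfun[OF ctx w] d0 d_t_zfun[OF ctx k w] 4 L(3)
    by (simp only: complex_cnj_diff complex_cnj_mult tilde') simp
  ultimately show "d_t k (zfun d w) t = poisson (Mfun d k) (zfun d) w t \<and>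
     d_t k (ztilde d w) t = poisson (Mfun d k) (ztilde d) w t \<and>
     d_tbar k (zfun d w) t = poisson (zfun d) (Mtilde d k) w t \<and>
     d_tbar k (ztilde d w) t = poisson (ztilde d) (Mtilde d k) w t"
    by blast
qed

end
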